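(* Consider either the asymmetric setting or the symmetric setting described in the context. Let $c>0$ and $f_c(z):=z\,\mathbf 1(|z|\le c)$. Assume the elements of $\sqrt n\,X_n$ converge to zero uniformly, that $\mu$ has a density $\omega$ that is continuous at $\pm c$, and that $\mathrm{Var}(f_c(z_{11}))>0$ for $z_{11}\sim\mu$. Let $F_\mu$ be the cumulative distribution function of $\mu$, let $Y_n:=n^{-1/2}f_c(\sqrt n\,X_n+Z_n)$, and define $$\tau(f_c,\mu):=\frac{F_\mu(c)-F_\mu(-c)-c(\omega(c)+\omega(-c))}{\sqrt{\mathrm{Var}(f_c(z_{11}))}},\qquad A_n:=\tau(f_c,\mu)\sqrt{\mathrm{Var}(f_c(z_{11}))}\,X_n+n^{-1/2}f_c(Z_n).$$ Then, as $n\to\infty$, $\|Y_n-A_n\|_2\xrightarrow{a.s.}0$.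
   Context: For $f:\mathbb{R}\to\mathbb{R}$ and a matrix $M$, $f(M)$ denotes elementwise application; $\|\cdot\|_2$ is the operator norm. All random matrices ($n\ge1$) are defined on a common probability space. No moment assumptions are made on $\mu$. Asymmetric setting: $X_n,Z_n$ are real $n\times p$ matrices, $p=p_n$, $p/n\to\gamma\in(0,\infty)$ as $n\to\infty$. $X_n$ is deterministic, of fixed rank $r$, with fixed (not depending on $n$) singular values $\sigma_1(X_n)>\cdots>\sigma_r(X_n)>0$. The elements of $Z_n$ are i.i.d. with law $\mu$ (a probability measure on $\mathbb{R}$ not depending on $n$). Symmetric setting: $X_n,Z_n$ are real symmetric $n\times n$ matrices. $X_n$ is deterministic, of fixed rank $r$, and its nonzero eigenvalues are fixed (not depending on $n$) and distinct. The upper triangular elements (including the diagonal) of $Z_n$ are i.i.d. with law $\mu$. *)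

theory Defs
  imports
    "HOL-Probability.Probability"
    "Jordan_Normal_Form.Char_Poly"
    "Jordan_Normal_Form.DL_Rank"
begin

definition vec_norm2 :: "real vec \<Rightarrow> real" where
  "vec_norm2 v = sqrt (scalar_prod v v)"

(* The unit ball rather than the unit sphere keeps the supremum over a nonempty set
   for matrices without columns. *)
definition op_norm :: "real mat \<Rightarrow> real" where
  "op_norm A = (SUP v\<in>{v \<in> carrier_vec (dim_col A). vec_norm2 v \<le> 1}. vec_norm2 (A *\<^sub>v v))"

definition singular_value :: "real mat \<Rightarrow> real \<Rightarrow> bool" where
  "singular_value A s \<longleftrightarrow> s \<ge> 0 \<and> eigenvalue (transpose_mat A * A) (s\<^sup>2)"

(* Rank r together with r distinct nonzero singular values sg 1 > ... > sg r leaves room only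
   for multiplicity one, so "set of nonzero singular values" loses no information.
   A matrix of rank r has at least r rows and columns, so the requirements on the spectrum of
   X n can only be meant for n large.
   No joint law is prescribed for the matrices Z n with different n. *)
locale asymmetric_setting = prob_space M + law: real_distribution \<mu>
  for M :: "'a measure" and \<mu> :: "real measure" +
  fixes p :: "nat \<Rightarrow> nat" and \<gamma> :: real
    and r :: nat and sg :: "nat \<Rightarrow> real"
    and X :: "nat \<Rightarrow> real mat" and Z :: "nat \<Rightarrow> 'a \<Rightarrow> real mat"
  assumes gamma_pos: "\<gamma> > 0"
    and aspect_ratio: "(\<lambda>n. real (p n) / real n) \<longlonglongrightarrow> \<gamma>"
    and X_carrier: "\<And>n. n \<ge> 1 \<Longrightarrow> X n \<in> carrier_mat n (p n)"
    and sg_decreasing: "\<And>k l. 1 \<le> k \<Longrightarrow> k < l \<Longrightarrow> l \<le> r \<Longrightarrow> sg l < sg k"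
    and sg_pos: "\<And>k. 1 \<le> k \<Longrightarrow> k \<le> r \<Longrightarrow> sg k > 0"
    and X_rank: "\<forall>\<^sub>F n in sequentially. vec_space.rank n (X n) = r"
    and X_singular_values:
      "\<forall>\<^sub>F n in sequentially. {s. singular_value (X n) s \<and> s \<noteq> 0} = sg ` {1..r}"
    and Z_carrier: "\<And>n w. n \<ge> 1 \<Longrightarrow> w \<in> space M \<Longrightarrow> Z n w \<in> carrier_mat n (p n)"
    and Z_indep: "\<And>n. n \<ge> 1 \<Longrightarrow>
      indep_vars (\<lambda>_. borel) (\<lambda>ij w. Z n w $$ ij) ({..<n} \<times> {..<p n})"
    and Z_law: "\<And>n i j. n \<ge> 1 \<Longrightarrow> i < n \<Longrightarrow> j < p n \<Longrightarrow> distr M borel (\<lambda>w. Z n w $$ (i, j)) = \<mu>"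

(* As above, distinctness of the r = rank X n nonzero eigenvalues (with multiplicity) is
   injectivity of ev on {1..r}. *)
locale symmetric_setting = prob_space M + law: real_distribution \<mu>
  for M :: "'a measure" and \<mu> :: "real measure" +
  fixes r :: nat and ev :: "nat \<Rightarrow> real"
    and X :: "nat \<Rightarrow> real mat" and Z :: "nat \<Rightarrow> 'a \<Rightarrow> real mat"
  assumes X_carrier: "\<And>n. n \<ge> 1 \<Longrightarrow> X n \<in> carrier_mat n n"
    and X_sym: "\<And>n. n \<ge> 1 \<Longrightarrow> transpose_mat (X n) = X n"
    and ev_distinct: "inj_on ev {1..r}"
    and X_rank: "\<forall>\<^sub>F n in sequentially. vec_space.rank n (X n) = r"
    and X_eigenvalues:
      "\<forall>\<^sub>F n in sequentially. {l. eigenvalue (X n) l \<and> l \<noteq> 0} = ev ` {1..r}"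
    and Z_carrier: "\<And>n w. n \<ge> 1 \<Longrightarrow> w \<in> space M \<Longrightarrow> Z n w \<in> carrier_mat n n"
    and Z_sym: "\<And>n w. n \<ge> 1 \<Longrightarrow> w \<in> space M \<Longrightarrow> transpose_mat (Z n w) = Z n w"
    and Z_indep: "\<And>n. n \<ge> 1 \<Longrightarrow>
      indep_vars (\<lambda>_. borel) (\<lambda>ij w. Z n w $$ ij) {(i, j). i \<le> j \<and> j < n}"
    and Z_law: "\<And>n i j. n \<ge> 1 \<Longrightarrow> i \<le> j \<Longrightarrow> j < n \<Longrightarrow> distr M borel (\<lambda>w. Z n w $$ (i, j)) = \<mu>"

definition trunc :: "real \<Rightarrow> real \<Rightarrow> real" where
  "trunc c z = (if \<bar>z\<bar> \<le> c then z else 0)"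

(* Var (f_c(z)) for z distributed according to mu *)
definition trunc_var :: "real measure \<Rightarrow> real \<Rightarrow> real" where
  "trunc_var \<mu> c = prob_space.variance \<mu> (trunc c)"

definition tau :: "real measure \<Rightarrow> (real \<Rightarrow> real) \<Rightarrow> real \<Rightarrow> real" where
  "tau \<mu> \<omega> c =
     (cdf \<mu> c - cdf \<mu> (- c) - c * (\<omega> c + \<omega> (- c))) / sqrt (trunc_var \<mu> c)"

definition Y_mat :: "real \<Rightarrow> (nat \<Rightarrow> real mat) \<Rightarrow> (nat \<Rightarrow> 'a \<Rightarrow> real mat) \<Rightarrow> nat \<Rightarrow> 'a \<Rightarrow> real mat" where
  "Y_mat c X Z n w =
     (1 / sqrt (real n)) \<cdot>\<^sub>m map_mat (trunc c) (sqrt (real n) \<cdot>\<^sub>m X n + Z n w)"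

definition A_mat :: "real measure \<Rightarrow> (real \<Rightarrow> real) \<Rightarrow> real \<Rightarrow> (nat \<Rightarrow> real mat) \<Rightarrow>
    (nat \<Rightarrow> 'a \<Rightarrow> real mat) \<Rightarrow> nat \<Rightarrow> 'a \<Rightarrow> real mat" where
  "A_mat \<mu> \<omega> c X Z n w =
     (tau \<mu> \<omega> c * sqrt (trunc_var \<mu> c)) \<cdot>\<^sub>m X n
     + (1 / sqrt (real n)) \<cdot>\<^sub>m map_mat (trunc c) (Z n w)"

end

theory Submission
  imports Defs "Jordan_Normal_Form.Schur_Decomposition"
begin

text \<open>
  Put \<open>e = sqrt n * X n $$ (i, j)\<close> and let \<open>t\<close> be the numerator of \<open>tau\<close>. The entry of
  \<open>Y - A\<close> is \<open>1 / sqrt n\<close> times \<open>f (e + z) - f z - t e\<close>. Its mean is \<open>o(e)\<close>, because \<open>t\<close> is the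
  derivative at \<open>0\<close> of the expectation of \<open>f (e + z)\<close>; as \<open>X n\<close> has bounded rank and bounded
  singular values, its Frobenius norm is bounded and the mean matrix is negligible.

  The centered entries are bounded and their variance tends to \<open>0\<close> uniformly, so their subgaussian
  parameter also tends to \<open>0\<close>. Hence for every \<open>\<eta> > 0\<close> a union bound over an exponentially large
  net of pairs of vectors shows that the operator norm of the centered matrix exceeds
  \<open>\<eta> * sqrt n\<close> with probability at most \<open>exp (- n)\<close>, and the Borel-Cantelli lemma applies without
  any assumption on the joint law for different \<open>n\<close>.
\<close>

subsection \<open>Frobenius norm, rank and singular values\<close>

text \<open>The net has \<open>exp (D * n)\<close> points, so a fixed subgaussian parameter would
  bound the operator norm of the centered matrix only by a constant times \<open>sqrt n\<close>,
  which is not negligible after division by \<open>sqrt n\<close>. A vanishing parameter is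
  therefore essential. It cannot come from smoothness: the truncation jumps at \<open>c\<close> and
  \<open>- c\<close>, and its increments are not uniformly small. Only their second moments are,
  because the jump points are null for a law with a density. For the Frobenius bound the obstacle is
  multiplicity: the nonzero spectrum is given as a set, and only the rank limits how often a value
  occurs. Counting nonzero diagonal entries of a triangular form of
  \<open>transpose_mat X * X\<close> connects the two without an orthogonal diagonalization.
  Bilinear rather than quadratic forms let both settings share one net; they differ only in how the
  exponential moment of a linear combination of entries factorizes.\<close>

lemma (in vec_space) card_lin_indpt_le_rank:
  assumes A: "A \<in> carrier_mat n nc" and U: "U \<subseteq> span (set (cols A))" "lin_indpt U"
  shows "card U \<le> rank A"
proof -
  have c: "set (cols A) \<subseteq> carrier V" using cols_dim[of A] A by auto
  have sub: "submodule class_ring (span (set (cols A))) V"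
    using span_is_submodule c by simp
  have vs: "vectorspace class_ring (span_vs (set (cols A)))"
    using c span_is_subspace subspace_def subspace_is_vs by simp
  have li: "\<not> LinearCombinations.module.lin_dep class_ring (span_vs (set (cols A))) U"
    using span_li_not_depend(2)[OF U(1) sub] U(2) by auto
  show ?thesis unfolding rank_def
    using vectorspace.li_le_dim(2)[OF vs fin_dim_span_cols[OF A] _ li] U(1) by simp
qed

text \<open>At the last index where \<open>v\<close> is nonzero, triangularity kills the row entries
  to the left and the choice of the index kills the contributions to the right. The diagonal entry
  there would have to vanish, but at such positions \<open>supp\<close> makes \<open>v\<close>
  zero.\<close>

lemma upper_triangular_kernel_eq_0:
  fixes B :: "'a :: idom mat"
  assumes B: "B \<in> carrier_mat p p" "upper_triangular B" and v: "v \<in> carrier_vec p"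
    and supp: "\<And>i. i < p \<Longrightarrow> B $$ (i, i) = 0 \<Longrightarrow> vec_index v i = 0"
    and ker: "B *\<^sub>v v = 0\<^sub>v p"
  shows "v = 0\<^sub>v p"
proof (rule ccontr)
  assume ne: "v \<noteq> 0\<^sub>v p"
  define S where "S = {i. i < p \<and> vec_index v i \<noteq> 0}"
  have "S \<noteq> {}" using ne v by (auto simp: S_def vec_eq_iff)
  moreover have "finite S" by (auto simp: S_def)
  ultimately have k: "Max S \<in> S" "\<And>i. i \<in> S \<Longrightarrow> i \<le> Max S" by auto
  define k where "k = Max S"
  have kp: "k < p" "vec_index v k \<noteq> 0" using k by (auto simp: S_def k_def)
  have "0 = vec_index (B *\<^sub>v v) k" using ker kp by simp
  also have "\<dots> = (\<Sum>j<p. B $$ (k, j) * vec_index v j)"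
    using B v kp by (simp add: scalar_prod_def lessThan_atLeast0)
  also have "\<dots> = (\<Sum>j\<in>{k}. B $$ (k, j) * vec_index v j)"
  proof (rule sum.mono_neutral_right)
    show "\<forall>j\<in>{..<p} - {k}. B $$ (k, j) * vec_index v j = 0"
    proof
      fix j assume j: "j \<in> {..<p} - {k}"
      show "B $$ (k, j) * vec_index v j = 0"
      proof (cases "j < k")
        case True then show ?thesis using B kp by (auto simp: upper_triangular_def)
      next
        case False
        then have "j \<notin> S" using k(2)[of j] j by (auto simp: k_def)
        then show ?thesis using j by (auto simp: S_def)
      qed
    qed
  qed (use kp in auto)
  finally have "B $$ (k, k) * vec_index v k = 0" by simp
  then show False using supp[of k] kp by auto
qed

lemma mult_mat_zero_vec: "(A :: 'a :: semiring_0 mat) \<in> carrier_mat n m \<Longrightarrow> A *\<^sub>v 0\<^sub>v m = 0\<^sub>v n"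
  by (intro eq_vecI) auto

text \<open>The columns of \<open>X * P\<close> at the nonzero diagonal positions of \<open>B\<close> are linearly independent
  elements of the column space of \<open>X\<close>.\<close>

lemma card_nonzero_diag_le_rank:
  fixes X :: "'a :: field mat"
  assumes X: "X \<in> carrier_mat n p"
    and sim: "similar_mat_wit (transpose_mat X * X) B P Q" and ut: "upper_triangular B"
  shows "card {i. i < p \<and> B $$ (i, i) \<noteq> 0} \<le> vec_space.rank n X"
proof -
  interpret vec_space "TYPE('a)" n .
  define I where "I = {i. i < p \<and> B $$ (i, i) \<noteq> 0}"
  have I: "finite I" "\<And>i. i \<in> I \<Longrightarrow> i < p" by (auto simp: I_def)
  have W: "transpose_mat X * X \<in> carrier_mat p p" using X by auto
  note D = similar_mat_witD2[OF W sim]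
  have PQ: "P \<in> carrier_mat p p" "Q \<in> carrier_mat p p" "B \<in> carrier_mat p p" using D by auto
  have XP: "X * P \<in> carrier_mat n p" using X PQ by auto
  define QX where "QX = Q * transpose_mat X"
  have QX: "QX \<in> carrier_mat p n" using PQ X by (auto simp: QX_def)
  \<comment> \<open>As \<open>P\<close> and \<open>Q\<close> are mutually inverse, the triangular
    form factors through \<open>X * P\<close>; hence every vector killed by \<open>X * P\<close> is
    killed by \<open>B\<close>.\<close>
  have "QX * (X * P) = Q * (transpose_mat X * X) * P"
  proof -
    have T: "transpose_mat X \<in> carrier_mat p n" using X by simp
    show ?thesis unfolding QX_def assoc_mult_mat[OF PQ(2) T XP] assoc_mult_mat[OF PQ(2) W PQ(1)]
      assoc_mult_mat[OF T X PQ(1)] ..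
  qed
  also have "\<dots> = Q * (P * B * Q) * P" using D(3) by simp
  also have "\<dots> = (Q * P) * B * (Q * P)"
    using PQ by (simp add: assoc_mult_mat[of _ p p _ p _ p])
  also have "\<dots> = B" using D(2) PQ by simp
  finally have BB: "B = QX * (X * P)" by simp
  have key: "v = 0\<^sub>v p" if v: "v \<in> carrier_vec p" "\<And>i. i < p \<Longrightarrow> i \<notin> I \<Longrightarrow> vec_index v i = 0"
    and z: "(X * P) *\<^sub>v v = 0\<^sub>v n" for v
  proof (rule upper_triangular_kernel_eq_0[OF PQ(3) ut v(1)])
    show "vec_index v i = 0" if "i < p" "B $$ (i, i) = 0" for i using v(2) that by (auto simp: I_def)
    have "B *\<^sub>v v = QX *\<^sub>v ((X * P) *\<^sub>v v)" using BB assoc_mult_mat_vec[OF QX XP v(1)] by simp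
    then show "B *\<^sub>v v = 0\<^sub>v p" using z mult_mat_zero_vec[OF QX] by simp
  qed
  define u where "u i = col (X * P) i" for i
  have u: "u i \<in> carrier_vec n" for i using X by (intro carrier_vecI) (simp add: u_def)
  \<comment> \<open>A linear relation between the columns \<open>u i\<close> becomes a kernel vector
    of \<open>X * P\<close> supported on \<open>I\<close>, to which \<open>key\<close>
    applies.\<close>
  have mv: "(X * P) *\<^sub>v vec p (\<lambda>i. if i \<in> I then a i else 0) = 0\<^sub>v n"
    if "\<And>k. k < n \<Longrightarrow> (\<Sum>i\<in>I. a i * vec_index (u i) k) = 0" for a
  proof (rule eq_vecI)
    fix k assume "k < dim_vec (0\<^sub>v n :: 'a vec)"
    then have k: "k < n" by simp
    have "vec_index (Y *\<^sub>v vec p (\<lambda>i. if i \<in> I then a i else 0)) k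
        = (\<Sum>i\<in>I. a i * vec_index (col Y i) k)" if Y: "Y \<in> carrier_mat n p" for Y
    proof -
      have "vec_index (Y *\<^sub>v vec p (\<lambda>i. if i \<in> I then a i else 0)) k
          = (\<Sum>i<p. Y $$ (k, i) * (if i \<in> I then a i else 0))"
        using Y k by (simp add: scalar_prod_def lessThan_atLeast0)
      also have "\<dots> = (\<Sum>i\<in>I. a i * vec_index (col Y i) k)"
        using I k Y by (intro sum.mono_neutral_cong_right) auto
      finally show ?thesis .
    qed
    from this[OF XP] have "vec_index ((X * P) *\<^sub>v vec p (\<lambda>i. if i \<in> I then a i else 0)) k
        = (\<Sum>i\<in>I. a i * vec_index (u i) k)" by (simp add: u_def)
    then    show "vec_index ((X * P) *\<^sub>v vec p (\<lambda>i. if i \<in> I then a i else 0)) k = vec_index (0\<^sub>v n) k"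
      using that[OF k] k by simp
  qed (use X in auto)
  \<comment> \<open>Needed to count indices instead of distinct columns: two equal columns would put
    the difference of two unit vectors into the kernel.\<close>
  have inj: "inj_on u I"
  proof (rule inj_onI, rule ccontr)
    fix i j assume ij: "i \<in> I" "j \<in> I" "u i = u j" "i \<noteq> j"
    define a where "a k = (if k = i then 1 else if k = j then - 1 else (0::'a))" for k
    have "(\<Sum>l\<in>I. a l * vec_index (u l) k) = (\<Sum>l\<in>{i,j}. a l * vec_index (u l) k)" for k
      using ij I by (intro sum.mono_neutral_right) (auto simp: a_def)
    also have "\<dots> k = 0" for k using ij by (simp add: a_def)
    finally have "vec p (\<lambda>i. if i \<in> I then a i else 0) = 0\<^sub>v p"
      by (intro key mv) auto
    then have "vec_index (vec p (\<lambda>i. if i \<in> I then a i else 0)) i = 0" using I ij by simp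
    then show False using I(2)[of i] ij by (simp add: a_def)
  qed
  have li: "lin_indpt (u ` I)"
  proof
    assume "lin_dep (u ` I)"
    then obtain a w where a: "lincomb a (u ` I) = 0\<^sub>v n" "w \<in> u ` I" "a w \<noteq> 0"
      using finite_lin_dep[of "u ` I"] I u by auto
    have "(\<Sum>i\<in>I. a (u i) * vec_index (u i) k) = 0" if k: "k < n" for k
    proof -
      have "vec_index (lincomb a (u ` I)) k = (\<Sum>x\<in>u ` I. a x * vec_index x k)"
        using u by (intro lincomb_index[OF k]) auto
      also have "\<dots> = (\<Sum>i\<in>I. a (u i) * vec_index (u i) k)" by (simp add: sum.reindex[OF inj])
      finally show ?thesis using a k by simp
    qed
    then have z: "vec p (\<lambda>i. if i \<in> I then a (u i) else 0) = 0\<^sub>v p"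
      by (intro key mv) auto
    obtain i where i: "i \<in> I" "w = u i" using a by auto
    have "vec_index (vec p (\<lambda>i. if i \<in> I then a (u i) else 0)) i = 0" using z I i by simp
    then show False using I(2)[of i] i a by simp
  qed
  have "u ` I \<subseteq> span (set (cols X))"
  proof safe
    fix i assume "i \<in> I"
    then have "u i = X *\<^sub>v col P i" using col_mult2[OF X PQ(1)] I by (auto simp: u_def)
    also have "\<dots> \<in> span (set (cols X))"
      using col_space_eq[OF X] X PQ unfolding col_space_def
      by (auto intro!: bexI[of _ "col P i"] carrier_vecI)
    finally show "u i \<in> span (set (cols X))" .
  qed
  from card_lin_indpt_le_rank[OF X this li] show ?thesis
    using card_image[OF inj] by (simp add: I_def)
qed


section \<open>Spectrum of real symmetric matrices and trace of the Gram matrix\<close>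

lemma real_scalar_prod_self:
  fixes v :: "real vec"
  shows "scalar_prod v v = (\<Sum>i<dim_vec v. (vec_index v i)\<^sup>2)"
  by (simp add: scalar_prod_def lessThan_atLeast0 power2_eq_square)

lemma real_scalar_prod_self_nonneg: "scalar_prod (v :: real vec) v \<ge> 0"
  by (simp add: real_scalar_prod_self sum_nonneg)

lemma real_scalar_prod_self_pos:
  assumes "(v :: real vec) \<in> carrier_vec p" "v \<noteq> 0\<^sub>v p"
  shows "scalar_prod v v > 0"
proof -
  obtain i where "i < p" "vec_index v i \<noteq> 0" using assms by (auto simp: vec_eq_iff)
  then show ?thesis using assms unfolding real_scalar_prod_self
    by (intro sum_pos2[of _ i]) auto
qed

text \<open>The Hermitian argument in real coordinates: with \<open>v = x + i y\<close>, moving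
  \<open>W\<close> across the scalar product of \<open>y\<close> and \<open>x\<close> leaves
  \<open>Im a\<close> times the sum of the two squared norms. Then \<open>x\<close> and
  \<open>y\<close> each satisfy the eigenvalue equation, and one of them is nonzero.\<close>

lemma symmetric_complex_eigenvalue:
  fixes W :: "real mat"
  assumes W: "W \<in> carrier_mat p p" "transpose_mat W = W"
    and ev: "eigenvalue (map_mat complex_of_real W) a"
  shows "Im a = 0" "eigenvalue W (Re a)"
proof -
  obtain v where v: "v \<in> carrier_vec p" "v \<noteq> 0\<^sub>v p" "map_mat complex_of_real W *\<^sub>v v = a \<cdot>\<^sub>v v"
    using ev W by (auto simp: eigenvalue_def eigenvector_def)
  define x y where "x = map_vec Re v" and "y = map_vec Im v"
  have xy: "x \<in> carrier_vec p" "y \<in> carrier_vec p" using v by (auto simp: x_def y_def)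
  have comp: "(\<Sum>j<p. complex_of_real (W $$ (i, j)) * vec_index v j) = a * vec_index v i" if "i < p" for i
    using arg_cong[OF v(3), of "\<lambda>u. vec_index u i"] that W v(1)
    by (simp add: scalar_prod_def lessThan_atLeast0)
  have Wx: "W *\<^sub>v x = Re a \<cdot>\<^sub>v x - Im a \<cdot>\<^sub>v y"
  proof (rule eq_vecI)
    fix i assume "i < dim_vec (Re a \<cdot>\<^sub>v x - Im a \<cdot>\<^sub>v y)"
    then have i: "i < p" using xy by simp
    show "vec_index (W *\<^sub>v x) i = vec_index (Re a \<cdot>\<^sub>v x - Im a \<cdot>\<^sub>v y) i"
      using arg_cong[OF comp[OF i], of Re] i W v(1)
      by (simp add: x_def y_def scalar_prod_def lessThan_atLeast0)
  qed (use W xy in auto)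
  have Wy: "W *\<^sub>v y = Re a \<cdot>\<^sub>v y + Im a \<cdot>\<^sub>v x"
  proof (rule eq_vecI)
    fix i assume "i < dim_vec (Re a \<cdot>\<^sub>v y + Im a \<cdot>\<^sub>v x)"
    then have i: "i < p" using xy by simp
    show "vec_index (W *\<^sub>v y) i = vec_index (Re a \<cdot>\<^sub>v y + Im a \<cdot>\<^sub>v x) i"
      using arg_cong[OF comp[OF i], of Im] i W v(1)
      by (simp add: x_def y_def scalar_prod_def lessThan_atLeast0)
  qed (use W xy in auto)
  have "scalar_prod (W *\<^sub>v y) x = scalar_prod y (W *\<^sub>v x)"
    using transpose_vec_mult_scalar[OF W(1) xy(1) xy(2)] W(2) by simp
  then have "Im a * (scalar_prod x x + scalar_prod y y) = 0"
    using xy by (simp add: Wx Wy add_scalar_prod_distrib[of _ p] scalar_prod_minus_distrib[of _ p]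
        algebra_simps comm_scalar_prod[of x p y])
  moreover have ne: "x \<noteq> 0\<^sub>v p \<or> y \<noteq> 0\<^sub>v p"
    using v(1,2) by (auto simp: x_def y_def vec_eq_iff complex_eq_iff)
  have "scalar_prod x x + scalar_prod y y \<noteq> 0"
    using ne real_scalar_prod_self_pos[OF xy(1)] real_scalar_prod_self_pos[OF xy(2)]
      real_scalar_prod_self_nonneg[of x] real_scalar_prod_self_nonneg[of y] by linarith
  ultimately show im: "Im a = 0" by simp
  have "W *\<^sub>v x = Re a \<cdot>\<^sub>v x" "W *\<^sub>v y = Re a \<cdot>\<^sub>v y"
    using Wx Wy im xy by auto
  then show "eigenvalue W (Re a)"
    using ne xy W(1) unfolding eigenvalue_def eigenvector_def by auto
qed

text \<open>Provides the list of real roots that the Schur decomposition takes as input. The complex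
  factorization descends to the reals because all roots are real and the embedding of polynomials is
  injective.\<close>

lemma symmetric_char_poly_splits:
  fixes W :: "real mat"
  assumes W: "W \<in> carrier_mat p p" "transpose_mat W = W"
  obtains es where "char_poly W = (\<Prod>e\<leftarrow>es. [:- e, 1:])"
proof -
  let ?C = "map_mat complex_of_real W"
  have C: "?C \<in> carrier_mat p p" using W by simp
  obtain as where as: "char_poly ?C = (\<Prod>a\<leftarrow>as. [:- a, 1:])"
    using char_poly_factorized[OF C] by auto
  have re: "complex_of_real (Re a) = a" if "a \<in> set as" for a
  proof -
    have "eigenvalue ?C a" unfolding eigenvalue_root_char_poly[OF C] as
      using that by (auto simp: poly_prod_list prod_list_zero_iff)
    then show ?thesis using symmetric_complex_eigenvalue(1)[OF W] by (simp add: complex_eq_iff)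
  qed
  interpret h: map_poly_inj_comm_ring_hom complex_of_real ..
  have "map_poly complex_of_real (char_poly W) = (\<Prod>a\<leftarrow>as. [:- a, 1:])"
    using as by (simp add: of_real_hom.char_poly_hom[OF W(1)])
  also have "\<dots> = (\<Prod>a\<leftarrow>map Re as. [:- complex_of_real a, 1:])"
    by (rule arg_cong[of _ _ prod_list]) (simp add: re)
  also have "\<dots> = map_poly complex_of_real (\<Prod>a\<leftarrow>map Re as. [:- a, 1:])"
    by (simp add: h.hom_prod_list o_def)
  finally have "char_poly W = (\<Prod>a\<leftarrow>map Re as. [:- a, 1:])" by (simp only: h.eq_iff)
  then show ?thesis by (rule that)
qed

lemma sum_diag_similar:
  fixes A :: "'a :: comm_ring_1 mat"
  assumes A: "A \<in> carrier_mat p p" and sim: "similar_mat_wit A B P Q"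
  shows "(\<Sum>i<p. A $$ (i, i)) = (\<Sum>i<p. B $$ (i, i))"
proof -
  note D = similar_mat_witD2[OF A sim]
  have swap: "(\<Sum>i<p. (C * D) $$ (i, i)) = (\<Sum>i<p. (D * C) $$ (i, i))"
    if "C \<in> carrier_mat p p" "D \<in> carrier_mat p p" for C D :: "'a mat"
  proof -
    have "(\<Sum>i<p. (C * D) $$ (i, i)) = (\<Sum>i<p. \<Sum>k<p. C $$ (i, k) * D $$ (k, i))"
      using that by (simp add: scalar_prod_def lessThan_atLeast0)
    also have "\<dots> = (\<Sum>k<p. \<Sum>i<p. D $$ (k, i) * C $$ (i, k))"
      by (subst sum.swap) (simp add: mult.commute)
    also have "\<dots> = (\<Sum>i<p. (D * C) $$ (i, i))"
      using that by (simp add: scalar_prod_def lessThan_atLeast0)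
    finally show ?thesis .
  qed
  have "(\<Sum>i<p. A $$ (i, i)) = (\<Sum>i<p. ((P * B) * Q) $$ (i, i))" using D by simp
  also have "\<dots> = (\<Sum>i<p. (Q * (P * B)) $$ (i, i))" using D by (intro swap) auto
  also have "Q * (P * B) = B" using D by (simp add: assoc_mult_mat[symmetric, of Q p p P p B p])
  finally show ?thesis .
qed

text \<open>Pairing the eigenvector with its image gives \<open>e\<close> times its squared norm as
  a squared norm. The sign makes \<open>sqrt e\<close> a singular value, so bounds on singular
  values become bounds on the spectrum.\<close>

lemma gram_eigenvalue_nonneg:
  fixes X :: "real mat"
  assumes X: "X \<in> carrier_mat n p" and ev: "eigenvalue (transpose_mat X * X) e"
  shows "e \<ge> 0"
proof -
  obtain v where v: "v \<in> carrier_vec p" "v \<noteq> 0\<^sub>v p" "(transpose_mat X * X) *\<^sub>v v = e \<cdot>\<^sub>v v"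
    using ev X by (auto simp: eigenvalue_def eigenvector_def)
  have Xv: "X *\<^sub>v v \<in> carrier_vec n" using X v by simp
  have "scalar_prod (X *\<^sub>v v) (X *\<^sub>v v) = scalar_prod (transpose_mat X *\<^sub>v (X *\<^sub>v v)) v"
    using transpose_vec_mult_scalar[OF X v(1) Xv] by simp
  also have "\<dots> = e * scalar_prod v v"
    using v X assoc_mult_mat_vec[of "transpose_mat X" p n X p v] by simp
  finally have "e * scalar_prod v v \<ge> 0"
    using real_scalar_prod_self_nonneg[of "X *\<^sub>v v"] by simp
  moreover have "scalar_prod v v > 0" using real_scalar_prod_self_pos v by blast
  ultimately show ?thesis by (simp add: zero_le_mult_iff)
qed

text \<open>The squared Frobenius norm is the trace of the Gram matrix, hence the sum of the
  diagonal of its triangular form. Each diagonal entry is an eigenvalue, at most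
  \<open>S\<^sup>2\<close>, and discarding the zero ones replaces the dimension \<open>p\<close> by
  the rank.\<close>

lemma frobenius_le_rank_times_singular_value:
  fixes X :: "real mat"
  assumes X: "X \<in> carrier_mat n p" and S: "\<And>s. singular_value X s \<Longrightarrow> s \<le> S"
  shows "(\<Sum>i<n. \<Sum>j<p. (X $$ (i, j))\<^sup>2) \<le> real (vec_space.rank n X) * S\<^sup>2"
proof -
  let ?W = "transpose_mat X * X"
  have W: "?W \<in> carrier_mat p p" "transpose_mat ?W = ?W"
    using X transpose_mult[of "transpose_mat X" p n X p] by auto
  obtain es where es: "char_poly ?W = (\<Prod>e\<leftarrow>es. [:- e, 1:])" using symmetric_char_poly_splits[OF W] .
  obtain B P Q where BPQ: "schur_decomposition ?W es = (B, P, Q)" by (cases "schur_decomposition ?W es") auto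
  have sim: "similar_mat_wit ?W B P Q" and ut: "upper_triangular B" and diag: "diag_mat B = es"
    using schur_decomposition[OF W(1) es BPQ] by auto
  have B: "B \<in> carrier_mat p p" using similar_mat_witD2[OF W(1) sim] by simp
  have le: "B $$ (i, i) \<le> S\<^sup>2" if "i < p" for i
  proof -
    have "B $$ (i, i) \<in> set es" using that B diag by (auto simp: diag_mat_def)
    then have "eigenvalue ?W (B $$ (i, i))" unfolding eigenvalue_root_char_poly[OF W(1)] es
      by (auto simp: poly_prod_list prod_list_zero_iff)
    moreover from this have nn: "B $$ (i, i) \<ge> 0" by (rule gram_eigenvalue_nonneg[OF X])
    ultimately have "singular_value X (sqrt (B $$ (i, i)))" by (simp add: singular_value_def)
    then have "sqrt (B $$ (i, i)) \<le> S" by (rule S)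
    then have "(sqrt (B $$ (i, i)))\<^sup>2 \<le> S\<^sup>2" using nn by (intro power_mono) auto
    then show ?thesis using nn by simp
  qed
  have "(\<Sum>i<n. \<Sum>j<p. (X $$ (i, j))\<^sup>2) = (\<Sum>j<p. \<Sum>i<n. (X $$ (i, j))\<^sup>2)" by (rule sum.swap)
  also have "\<dots> = (\<Sum>j<p. ?W $$ (j, j))"
    using X by (simp add: scalar_prod_def lessThan_atLeast0 power2_eq_square)
  also have "\<dots> = (\<Sum>i<p. B $$ (i, i))" by (rule sum_diag_similar[OF W(1) sim])
  also have "\<dots> = (\<Sum>i\<in>{i. i < p \<and> B $$ (i, i) \<noteq> 0}. B $$ (i, i))"
    by (intro sum.mono_neutral_right) auto
  also have "\<dots> \<le> real (card {i. i < p \<and> B $$ (i, i) \<noteq> 0}) * S\<^sup>2"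
    using sum_bounded_above[of "{i. i < p \<and> B $$ (i, i) \<noteq> 0}" "\<lambda>i. B $$ (i, i)" "S\<^sup>2"] le by auto
  also have "\<dots> \<le> real (vec_space.rank n X) * S\<^sup>2"
    using card_nonzero_diag_le_rank[OF X sim ut] by (intro mult_right_mono) auto
  finally show ?thesis .
qed

text \<open>Factor \<open>X\<^sup>2 - s\<^sup>2\<close> as \<open>(X + s) (X - s)\<close>: either
  \<open>X - s\<close> kills the eigenvector \<open>v\<close> of the square, or its image
  \<open>u\<close> is an eigenvector for \<open>- s\<close>.\<close>

lemma symmetric_singular_value:
  assumes X: "X \<in> carrier_mat n n" "transpose_mat X = X" and s: "singular_value X s"
  shows "eigenvalue X s \<or> eigenvalue X (- s)"
proof -
  obtain v where v: "v \<in> carrier_vec n" "v \<noteq> 0\<^sub>v n" "(X * X) *\<^sub>v v = s\<^sup>2 \<cdot>\<^sub>v v"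
    using s X by (auto simp: singular_value_def eigenvalue_def eigenvector_def)
  define u where "u = X *\<^sub>v v - s \<cdot>\<^sub>v v"
  have u: "u \<in> carrier_vec n" using X v by (auto simp: u_def)
  show ?thesis
  proof (cases "u = 0\<^sub>v n")
    case True
    have "X *\<^sub>v v = s \<cdot>\<^sub>v v"
    proof (rule eq_vecI)
      fix i assume i: "i < dim_vec (s \<cdot>\<^sub>v v)"
      then show "vec_index (X *\<^sub>v v) i = vec_index (s \<cdot>\<^sub>v v) i"
        using arg_cong[OF True, of "\<lambda>u. vec_index u i"] v X by (simp add: u_def)
    qed (use X v in auto)
    then show ?thesis using v X unfolding eigenvalue_def eigenvector_def by auto
  next
    case False
    have "X *\<^sub>v u = (X * X) *\<^sub>v v - s \<cdot>\<^sub>v (X *\<^sub>v v)"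
      using X(1) v(1) unfolding u_def
      by (simp add: mult_minus_distrib_mat_vec[of X n n] mult_mat_vec[of X n n])
    also have "\<dots> = (- s) \<cdot>\<^sub>v u"
      unfolding v(3) u_def using X v
      by (intro eq_vecI) (auto simp: algebra_simps power2_eq_square)
    finally show ?thesis using u False X unfolding eigenvalue_def eigenvector_def by auto
  qed
qed

subsection \<open>A lattice net for bilinear forms\<close>

text \<open>Integer points that land in the unit ball after division by \<open>4 * sqrt n\<close>.
  Extensional functions make the set finite.\<close>

definition lattice_ball :: "nat \<Rightarrow> (nat \<Rightarrow> int) set" where
  "lattice_ball n = {a \<in> {..<n} \<rightarrow>\<^sub>E UNIV. (\<Sum>i<n. (a i)\<^sup>2) \<le> 16 * int n}"

text \<open>A bound on the theta sum that is uniform in \<open>m\<close>; it is the one-dimensional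
  factor in the lattice count. The \<open>3\<close> is \<open>1\<close> from \<open>k = 0\<close>
  plus at most \<open>1\<close> from each side, by comparison with powers of
  \<open>1/2\<close>.\<close>

lemma sum_exp_neg_squares_le: "(\<Sum>k\<in>{-int m..int m}. exp (- (real_of_int k)\<^sup>2)) \<le> 3"
proof -
  have half: "(\<Sum>k\<in>{1..m}. exp (- (real k)\<^sup>2)) \<le> 1"
  proof -
    have e: "exp (- (real k)\<^sup>2) \<le> (1/2) ^ k" if "k \<ge> 1" for k
    proof -
      have "real k \<le> (real k)\<^sup>2" using that by (simp add: power2_eq_square)
      then have "exp (- (real k)\<^sup>2) \<le> exp (real k * (- 1))" by simp
      also have "\<dots> = exp (- 1) ^ k" by (rule exp_of_nat_mult)
      also have "\<dots> \<le> (1/2) ^ k"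
        using exp_ge_add_one_self[of 1] by (intro power_mono) (auto simp: exp_minus field_simps)
      finally show ?thesis .
    qed
    have "(\<Sum>k\<in>{1..m}. exp (- (real k)\<^sup>2)) \<le> (\<Sum>k\<in>{1..m}. (1/2) ^ k)"
      using e by (intro sum_mono) auto
    also have "\<dots> \<le> 1" by (induction m) (auto simp: sum_gp)
    finally show ?thesis .
  qed
  have eq: "{-int m..int m} = insert 0 (int ` {1..m} \<union> (\<lambda>k. - int k) ` {1..m})"
  proof (intro equalityI subsetI)
    fix x assume x: "x \<in> {-int m..int m}"
    consider "x = 0" | "x > 0" | "x < 0" by linarith
    then show "x \<in> insert 0 (int ` {1..m} \<union> (\<lambda>k. - int k) ` {1..m})"
    proof cases
      case 2 then show ?thesis using x by (intro insertI2 UnI1 image_eqI[of _ _ "nat x"]) auto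
    next
      case 3 then show ?thesis using x by (intro insertI2 UnI2 image_eqI[of _ _ "nat (- x)"]) auto
    qed auto
  qed auto
  have "(\<Sum>k\<in>{-int m..int m}. exp (- (real_of_int k)\<^sup>2))
      = 1 + ((\<Sum>k\<in>int ` {1..m}. exp (- (real_of_int k)\<^sup>2))
          + (\<Sum>k\<in>(\<lambda>k. - int k) ` {1..m}. exp (- (real_of_int k)\<^sup>2)))"
    unfolding eq by (subst sum.insert) (auto intro!: sum.union_disjoint)
  also have "\<dots> = 1 + ((\<Sum>k\<in>{1..m}. exp (- (real k)\<^sup>2)) + (\<Sum>k\<in>{1..m}. exp (- (real k)\<^sup>2)))"
    by (simp add: sum.reindex inj_on_def)
  finally show ?thesis using half by linarith
qed

text \<open>The box is crude, but it is a finite product, as finiteness and the factorization of the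
  exponential sum require.\<close>

lemma lattice_ball_subset: "lattice_ball n \<subseteq> {..<n} \<rightarrow>\<^sub>E {- int (16 * n)..int (16 * n)}"
proof
  fix a assume a: "a \<in> lattice_ball n"
  have "a i \<in> {- int (16 * n)..int (16 * n)}" if i: "i < n" for i
  proof -
    have "\<bar>a i\<bar> \<le> \<bar>a i\<bar> * \<bar>a i\<bar>" by (cases "a i = 0") (auto intro: mult_right_mono[of 1 "\<bar>a i\<bar>" "\<bar>a i\<bar>", simplified])
    also have "\<dots> = (a i)\<^sup>2" by (simp add: power2_eq_square)
    also have "\<dots> \<le> (\<Sum>i<n. (a i)\<^sup>2)" using i by (intro member_le_sum) auto
    also have "\<dots> \<le> 16 * int n" using a by (simp add: lattice_ball_def)
    finally show ?thesis by auto
  qed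
  then show "a \<in> {..<n} \<rightarrow>\<^sub>E {- int (16 * n)..int (16 * n)}"
    using a by (auto simp: lattice_ball_def PiE_iff)
qed

lemma finite_lattice_ball: "finite (lattice_ball n)"
  by (rule finite_subset[OF lattice_ball_subset]) (auto intro: finite_PiE)

text \<open>Every lattice point \<open>a\<close> of the ball contributes at least \<open>1\<close> to
  \<open>\<Sum>a. exp (16 n - \<Sum>i. a i ^ 2)\<close>, and this sum over the whole lattice factorizes.\<close>

lemma card_lattice_ball: "real (card (lattice_ball n)) \<le> (3 * exp 16) ^ n"
proof -
  let ?B = "{..<n} \<rightarrow>\<^sub>E {- int (16 * n)..int (16 * n)}"
  have fin: "finite ?B" by (auto intro: finite_PiE)
  have "real (card (lattice_ball n)) = (\<Sum>a\<in>lattice_ball n. 1)" by simp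
  also have "\<dots> \<le> (\<Sum>a\<in>lattice_ball n. exp (16 * real n - (\<Sum>i<n. (real_of_int (a i))\<^sup>2)))"
  proof (rule sum_mono)
    fix a assume "a \<in> lattice_ball n"
    then have "real_of_int (\<Sum>i<n. (a i)\<^sup>2) \<le> real_of_int (16 * int n)"
      unfolding of_int_le_iff by (simp add: lattice_ball_def)
    then show "1 \<le> exp (16 * real n - (\<Sum>i<n. (real_of_int (a i))\<^sup>2))" by simp
  qed
  also have "\<dots> \<le> (\<Sum>a\<in>?B. exp (16 * real n - (\<Sum>i<n. (real_of_int (a i))\<^sup>2)))"
    using fin lattice_ball_subset by (intro sum_mono2) auto
  also have "\<dots> = (\<Sum>a\<in>?B. exp (16 * real n) * (\<Prod>i<n. exp (- (real_of_int (a i))\<^sup>2)))"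
    by (simp add: diff_conv_add_uminus sum_negf[symmetric] exp_add exp_sum del: add_uminus_conv_diff)
  also have "\<dots> = exp (16 * real n) * (\<Prod>i<n. \<Sum>k\<in>{- int (16 * n)..int (16 * n)}. exp (- (real_of_int k)\<^sup>2))"
    by (subst prod_sum_PiE) (auto simp: sum_distrib_left)
  also have "\<dots> \<le> exp (16 * real n) * (\<Prod>i<n. 3)"
    using sum_exp_neg_squares_le[of "16 * n"]
    by (intro mult_left_mono prod_mono) (auto intro: sum_nonneg)
  also have "\<dots> = (3 * exp 16) ^ n"
    using exp_of_nat_mult[of n "16::real"] by (simp add: power_mult_distrib mult.commute)
  finally show ?thesis .
qed

text \<open>Each coordinate is off by at most \<open>1 / (4 * sqrt n)\<close>, so the error has
  squared norm at most \<open>1 / 16\<close>, and four times the error lies in the unit ball again.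
  This self-similar form is what the absorption argument for bilinear forms uses.\<close>

lemma lattice_ball_approx:
  assumes n: "n \<ge> 1" and x: "(\<Sum>i<n. (x i)\<^sup>2) \<le> (1::real)"
  obtains a where "a \<in> lattice_ball n"
    "(\<Sum>i<n. (real_of_int (a i) / (4 * sqrt n))\<^sup>2) \<le> 1"
    "(\<Sum>i<n. (4 * (x i - real_of_int (a i) / (4 * sqrt n)))\<^sup>2) \<le> 1"
proof -
  define K where "K = 4 * sqrt n"
  have K: "K > 0" "K\<^sup>2 = 16 * real n" using n by (auto simp: K_def power_mult_distrib)
  \<comment> \<open>Rounding towards zero: it does not increase any coordinate in absolute value, so
    the rounded point stays in the ball. Rounding to the nearest integer could leave it.\<close>
  define a where "a = (\<lambda>i\<in>{..<n}. if x i \<ge> 0 then \<lfloor>K * x i\<rfloor> else \<lceil>K * x i\<rceil>)"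
  have a1: "\<bar>real_of_int (a i)\<bar> \<le> \<bar>K * x i\<bar>" and a2: "\<bar>K * x i - real_of_int (a i)\<bar> \<le> 1" if "i < n" for i
  proof -
    show "\<bar>real_of_int (a i)\<bar> \<le> \<bar>K * x i\<bar>"
    proof (cases "x i \<ge> 0")
      case True
      then have "K * x i \<ge> 0" using K by simp
      then show ?thesis using True that by (simp add: a_def)
    next
      case False
      then have "K * x i < 0" using K by (simp add: mult_pos_neg)
      then have "\<lceil>K * x i\<rceil> \<le> 0" by linarith
      moreover have "K * x i \<le> \<lceil>K * x i\<rceil>" by simp
      ultimately show ?thesis using False that \<open>K * x i < 0\<close> by (simp add: a_def)
    qed
    show "\<bar>K * x i - real_of_int (a i)\<bar> \<le> 1"
      using that by (simp add: a_def) linarith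
  qed
  have u: "\<bar>real_of_int (a i) / K\<bar> \<le> \<bar>x i\<bar>" if "i < n" for i
    using a1[OF that] K by (simp add: abs_mult field_simps)
  have "(\<Sum>i<n. (real_of_int (a i) / K)\<^sup>2) \<le> (\<Sum>i<n. (x i)\<^sup>2)"
    using u by (intro sum_mono abs_le_square_iff[THEN iffD1]) auto
  then have s: "(\<Sum>i<n. (real_of_int (a i) / K)\<^sup>2) \<le> 1" using x by linarith
  have "(\<Sum>i<n. (real_of_int (a i))\<^sup>2) = K\<^sup>2 * (\<Sum>i<n. (real_of_int (a i) / K)\<^sup>2)"
    unfolding sum_distrib_left using K(1) by (intro sum.cong refl) (simp add: power_divide)
  also have "\<dots> \<le> 16 * real n" using s K by (simp add: mult_left_le)
  finally have "real_of_int (\<Sum>i<n. (a i)\<^sup>2) \<le> real_of_int (16 * int n)" by simp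
  then have "a \<in> lattice_ball n"
    unfolding of_int_le_iff by (simp add: lattice_ball_def a_def)
  moreover have "(\<Sum>i<n. (4 * (x i - real_of_int (a i) / K))\<^sup>2) \<le> 1"
  proof -
    have "(4 * (x i - real_of_int (a i) / K))\<^sup>2 \<le> 1 / real n" if "i < n" for i
    proof -
      have "(4 * (x i - real_of_int (a i) / K))\<^sup>2 = 16 * (K * x i - real_of_int (a i))\<^sup>2 / K\<^sup>2"
        using K(1) by (simp add: field_simps power2_eq_square)
      also have "\<dots> \<le> 16 * 1 / K\<^sup>2"
        using a2[OF that] K by (intro divide_right_mono mult_left_mono) (auto simp: abs_square_le_1)
      finally show ?thesis using K by simp
    qed
    then have "(\<Sum>i<n. (4 * (x i - real_of_int (a i) / K))\<^sup>2) \<le> (\<Sum>i<n. 1 / real n)"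
      by (intro sum_mono) auto
    then show ?thesis using n by simp
  qed
  ultimately show ?thesis using s that unfolding K_def by blast
qed

text \<open>Replacing \<open>x\<close> and \<open>y\<close> by lattice points costs two bilinear
  forms whose difference argument is a quarter of a unit ball vector. The supremum is thus at most
  \<open>T\<close> plus half of itself.\<close>

lemma bilinear_le_of_lattice_le:
  fixes w :: "nat \<Rightarrow> nat \<Rightarrow> real"
  assumes T: "T \<ge> 0"
    and net: "\<And>a b. a \<in> lattice_ball n \<Longrightarrow> b \<in> lattice_ball p \<Longrightarrow>
      (\<Sum>i<n. \<Sum>j<p. (real_of_int (a i) / (4 * sqrt n)) * (real_of_int (b j) / (4 * sqrt p)) * w i j) \<le> T"
    and x: "(\<Sum>i<n. (x i)\<^sup>2) \<le> 1" and y: "(\<Sum>j<p. (y j)\<^sup>2) \<le> 1"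
  shows "(\<Sum>i<n. \<Sum>j<p. x i * y j * w i j) \<le> 2 * T"
\<comment> \<open>All sums are empty here, so \<open>T \<ge> 0\<close> is what counts; otherwise the
  scaling factors of the lattice are nonzero.\<close>
proof (cases "n = 0 \<or> p = 0")
  case True
  then show ?thesis using T by auto
next
  case False
  then have np: "n \<ge> 1" "p \<ge> 1" by auto
  define bil where "bil x y = (\<Sum>i<n. \<Sum>j<p. x i * y j * w i j)" for x y :: "nat \<Rightarrow> real"
  define U where "U m = {x :: nat \<Rightarrow> real. (\<Sum>i<m. (x i)\<^sup>2) \<le> 1}" for m :: nat
  define F where "F = {bil x y | x y. x \<in> U n \<and> y \<in> U p}"
  have coord: "\<bar>x i\<bar> \<le> 1" if "x \<in> U m" "i < m" for x m i
  proof -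
    have "(x i)\<^sup>2 \<le> (\<Sum>i<m. (x i)\<^sup>2)" using that by (intro member_le_sum) auto
    then show ?thesis using that by (simp add: U_def abs_square_le_1[symmetric])
  qed
  \<comment> \<open>Makes the supremum finite; otherwise absorbing half of it at the end would be
    illegitimate.\<close>
  have bound: "bil x y \<le> (\<Sum>i<n. \<Sum>j<p. \<bar>w i j\<bar>)" if "x \<in> U n" "y \<in> U p" for x y
    unfolding bil_def
  proof (intro sum_mono)
    fix i j assume "i \<in> {..<n}" "j \<in> {..<p}"
    then have "\<bar>x i * y j\<bar> * \<bar>w i j\<bar> \<le> 1 * \<bar>w i j\<bar>"
      using coord[OF that(1), of i] coord[OF that(2), of j]
      by (intro mult_right_mono) (auto simp: abs_mult intro!: mult_le_one)
    then show "x i * y j * w i j \<le> \<bar>w i j\<bar>"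
      using abs_ge_self[of "x i * y j * w i j"] by (simp add: abs_mult)
  qed
  have bdd: "bdd_above F" unfolding F_def by (intro bdd_aboveI) (auto dest: bound)
  have zero: "(\<lambda>_. 0) \<in> U m" for m by (simp add: U_def)
  have ne: "F \<noteq> {}" using zero unfolding F_def by blast
  have up: "bil x y \<le> Sup F" if "x \<in> U n" "y \<in> U p" for x y
    using that bdd by (intro cSup_upper) (auto simp: F_def)
  have step: "bil x y \<le> T + Sup F / 2" if xy: "x \<in> U n" "y \<in> U p" for x y
  proof -
    obtain a where a: "a \<in> lattice_ball n" "(\<lambda>i. real_of_int (a i) / (4 * sqrt n)) \<in> U n"
      "(\<lambda>i. 4 * (x i - real_of_int (a i) / (4 * sqrt n))) \<in> U n"
      unfolding U_def mem_Collect_eq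
      by (rule lattice_ball_approx[OF np(1) xy(1)[unfolded U_def mem_Collect_eq]])
    obtain b where b: "b \<in> lattice_ball p" "(\<lambda>i. real_of_int (b i) / (4 * sqrt p)) \<in> U p"
      "(\<lambda>i. 4 * (y i - real_of_int (b i) / (4 * sqrt p))) \<in> U p"
      unfolding U_def mem_Collect_eq
      by (rule lattice_ball_approx[OF np(2) xy(2)[unfolded U_def mem_Collect_eq]])
    define u v where "u i = real_of_int (a i) / (4 * sqrt n)" and "v i = real_of_int (b i) / (4 * sqrt p)" for i
    \<comment> \<open>Telescoping: first replace \<open>x\<close> by \<open>u\<close> against
      \<open>y\<close>, then \<open>y\<close> by \<open>v\<close> against \<open>u\<close>. The
      factors \<open>4\<close> and \<open>1/4\<close> rescale the errors to unit ball
      vectors.\<close>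
    have "bil x y = bil u v + bil (\<lambda>i. 4 * (x i - u i)) y / 4 + bil u (\<lambda>j. 4 * (y j - v j)) / 4"
      unfolding bil_def sum_divide_distrib sum.distrib[symmetric]
      by (intro sum.cong refl) (simp add: field_simps)
    moreover have "bil u v \<le> T" using net[OF a(1) b(1)] by (simp add: bil_def u_def v_def)
    moreover have "bil (\<lambda>i. 4 * (x i - u i)) y \<le> Sup F" "bil u (\<lambda>j. 4 * (y j - v j)) \<le> Sup F"
      using up a b xy by (simp_all add: u_def[abs_def] v_def[abs_def])
    ultimately show ?thesis by linarith
  qed
  have "v \<le> T + Sup F / 2" if v: "v \<in> F" for v
  proof -
    obtain x y where "v = bil x y" "x \<in> U n" "y \<in> U p" using v unfolding F_def by blast
    then show ?thesis using step by simp
  qed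
  then have "Sup F \<le> T + Sup F / 2" by (rule cSup_least[OF ne])
  then have "Sup F \<le> 2 * T" by simp
  moreover have "bil x y \<le> Sup F" using x y by (intro up) (auto simp: U_def)
  ultimately show ?thesis by (simp add: bil_def)
qed

subsection \<open>Concentration of bilinear forms\<close>

text \<open>Second-order Taylor expansion. The square stays outside the exponential, so that after
  integration a small second moment makes the whole correction small.\<close>

lemma exp_le_quadratic: "exp x \<le> 1 + x + x\<^sup>2 * exp \<bar>x\<bar>" for x :: real
proof -
  obtain t where t: "\<bar>t\<bar> \<le> \<bar>x\<bar>" "exp x = (\<Sum>m<2. x ^ m / fact m) + exp t / fact 2 * x ^ 2"
    using Maclaurin_exp_le[of x 2] by blast
  have "exp t * x\<^sup>2 \<le> exp \<bar>x\<bar> * x\<^sup>2" using t(1) by (intro mult_right_mono) auto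
  moreover have "exp t * x\<^sup>2 \<ge> 0" by simp
  moreover have "exp x = 1 + x + exp t * x\<^sup>2 / 2" using t(2) by (simp add: numeral_2_eq_2)
  ultimately show ?thesis unfolding mult.commute[of "x\<^sup>2"] by linarith
qed

text \<open>For small \<open>l\<close> the variance bound controls the exponential moment, for \<open>\<bar>l\<bar> > L\<close> the
  uniform bound alone does; hence a bounded variable of small variance is subgaussian with a small
  parameter.\<close>

lemma (in prob_space) exp_moment_le:
  fixes Y :: "'a \<Rightarrow> real"
  assumes [measurable]: "Y \<in> borel_measurable M"
    and bnd: "\<And>w. w \<in> space M \<Longrightarrow> \<bar>Y w\<bar> \<le> K"
    and mean: "expectation Y = 0" and var: "expectation (\<lambda>w. (Y w)\<^sup>2) \<le> d"
    and L: "L > 0" "K \<le> s * L" "d * exp (L * K) \<le> s"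
  shows "expectation (\<lambda>w. exp (l * Y w)) \<le> exp (s * l\<^sup>2)"
proof (cases "\<bar>l\<bar> \<le> L")
  case True
  have K: "K \<ge> 0"
  proof -
    obtain w where "w \<in> space M" using not_empty by blast
    from bnd[OF this] show ?thesis by linarith
  qed
  have int: "integrable M Y" "integrable M (\<lambda>w. (Y w)\<^sup>2)" "integrable M (\<lambda>w. exp (l * Y w))"
  proof -
    show "integrable M Y" using bnd by (intro integrable_const_bound[where B = K]) auto
    show "integrable M (\<lambda>w. (Y w)\<^sup>2)"
      using bnd K by (intro integrable_const_bound[where B = "K\<^sup>2"]) (auto simp: abs_le_square_iff[symmetric])
    have "l * Y w \<le> \<bar>l\<bar> * K" if "w \<in> space M" for w
      using bnd[OF that] mult_left_mono[of "\<bar>Y w\<bar>" K "\<bar>l\<bar>"] abs_ge_self[of "l * Y w"] by (simp add: abs_mult)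
    then show "integrable M (\<lambda>w. exp (l * Y w))"
      by (intro integrable_const_bound[where B = "exp (\<bar>l\<bar> * K)"]) auto
  qed
  have "exp (l * Y w) \<le> 1 + l * Y w + (l\<^sup>2 * exp (L * K)) * (Y w)\<^sup>2" if "w \<in> space M" for w
  proof -
    have "\<bar>l * Y w\<bar> \<le> L * K" using True bnd[OF that] K by (auto simp: abs_mult intro!: mult_mono)
    then have "(l * Y w)\<^sup>2 * exp \<bar>l * Y w\<bar> \<le> (l * Y w)\<^sup>2 * exp (L * K)" by (intro mult_left_mono) auto
    then show ?thesis using exp_le_quadratic[of "l * Y w"] by (simp add: power_mult_distrib ac_simps)
  qed
  then have "expectation (\<lambda>w. exp (l * Y w))
      \<le> expectation (\<lambda>w. 1 + l * Y w + (l\<^sup>2 * exp (L * K)) * (Y w)\<^sup>2)"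
    using int by (intro integral_mono) auto
  also have "\<dots> = 1 + l\<^sup>2 * exp (L * K) * expectation (\<lambda>w. (Y w)\<^sup>2)"
    using int by (simp add: mean prob_space)
  also have "\<dots> \<le> 1 + l\<^sup>2 * (d * exp (L * K))"
    using mult_left_mono[OF var, of "l\<^sup>2 * exp (L * K)"] by (simp add: ac_simps)
  also have "\<dots> \<le> 1 + l\<^sup>2 * s" using L(3) by (intro add_left_mono mult_left_mono) auto
  also have "\<dots> \<le> exp (s * l\<^sup>2)" using exp_ge_add_one_self[of "s * l\<^sup>2"] by (simp add: mult.commute)
  finally show ?thesis .
next
  case False
  have K: "K \<ge> 0"
  proof -
    obtain w where "w \<in> space M" using not_empty by blast
    from bnd[OF this] show ?thesis by linarith
  qed
  have "exp (l * Y w) \<le> exp (s * l\<^sup>2)" if "w \<in> space M" for w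
  proof -
    have s: "s \<ge> 0" using L K by (smt (verit) mult_neg_pos)
    have "l * Y w \<le> \<bar>l\<bar> * K"
      using bnd[OF that] mult_left_mono[of "\<bar>Y w\<bar>" K "\<bar>l\<bar>"] abs_ge_self[of "l * Y w"] by (simp add: abs_mult)
    \<comment> \<open>\<open>K \<le> s * L\<close> followed by \<open>L < \<bar>l\<bar>\<close>
      turns an exponent linear in \<open>l\<close> into a quadratic one.\<close>
    also have "\<dots> \<le> \<bar>l\<bar> * (s * L)" using L by (intro mult_left_mono) auto
    also have "\<dots> = (s * \<bar>l\<bar>) * L" by simp
    also have "\<dots> \<le> (s * \<bar>l\<bar>) * \<bar>l\<bar>" using False s by (intro mult_left_mono) auto
    also have "\<dots> = s * l\<^sup>2" by (simp add: power2_eq_square)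
    finally show ?thesis by simp
  qed
  then show ?thesis by (intro integral_le_const integrable_const_bound[where B = "exp (s * l\<^sup>2)"]) auto
qed

lemma sum_lattice_ball_le:
  assumes "a \<in> lattice_ball n"
  shows "(\<Sum>i<n. (real_of_int (a i) / (4 * sqrt n))\<^sup>2) \<le> 1"
proof (cases "n = 0")
  case False
  have "real_of_int (\<Sum>i<n. (a i)\<^sup>2) \<le> real_of_int (16 * int n)"
    using assms unfolding of_int_le_iff by (simp add: lattice_ball_def)
  then have "(\<Sum>i<n. (real_of_int (a i))\<^sup>2) / (16 * real n) \<le> 1" using False by simp
  then show ?thesis by (simp add: power_divide power_mult_distrib sum_divide_distrib)
qed simp

lemma (in prob_space) prob_gt_le_exp_moment:
  fixes S :: "'a \<Rightarrow> real"
  assumes [measurable]: "S \<in> borel_measurable M" and l: "l > 0"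
    and int: "integrable M (\<lambda>w. exp (l * S w))"
  shows "prob {w \<in> space M. t < S w} \<le> exp (- l * t) * expectation (\<lambda>w. exp (l * S w))"
proof -
  have "prob {w \<in> space M. t < S w} \<le> prob {w \<in> space M. t \<le> S w}"
    by (intro finite_measure_mono) auto
  also have "\<dots> \<le> exp (- l * t) * set_lebesgue_integral M (space M) (\<lambda>w. exp (l * S w))"
  proof (intro Chernoff_ineq_ge l)
    show "set_integrable M (space M) (\<lambda>w. exp (l * S w))"
      unfolding set_integrable_def using int by (rule Bochner_Integration.integrable_cong[OF refl, THEN iffD2, rotated]) simp
  qed auto
  also have "set_lebesgue_integral M (space M) (\<lambda>w. exp (l * S w)) = expectation (\<lambda>w. exp (l * S w))"
    using int by (rule set_integral_space)
  finally show ?thesis .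
qed

text \<open>\<open>subg\<close> is required for every \<open>s\<close>, since a smaller
  \<open>\<eta>\<close> calls for a smaller parameter if the Chernoff bound is to beat the
  cardinality of the net.\<close>

proposition (in prob_space) AE_bilinear_le:
  fixes W :: "nat \<Rightarrow> 'a \<Rightarrow> nat \<Rightarrow> nat \<Rightarrow> real" and C :: nat
  assumes meas: "\<And>n i j. i < n \<Longrightarrow> j < p n \<Longrightarrow> (\<lambda>w. W n w i j) \<in> borel_measurable M"
    and bnd: "\<And>n w i j. w \<in> space M \<Longrightarrow> i < n \<Longrightarrow> j < p n \<Longrightarrow> \<bar>W n w i j\<bar> \<le> K"
    and p: "\<forall>\<^sub>F n in sequentially. p n \<le> C * n"
    and subg: "\<And>s. s > 0 \<Longrightarrow> \<forall>\<^sub>F n in sequentially. \<forall>a.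
      expectation (\<lambda>w. exp (\<Sum>i<n. \<Sum>j<p n. a i j * W n w i j)) \<le> exp (s * (\<Sum>i<n. \<Sum>j<p n. (a i j)\<^sup>2))"
    and \<eta>: "\<eta> > 0"
  shows "AE w in M. \<forall>\<^sub>F n in sequentially. \<forall>x y. (\<Sum>i<n. (x i)\<^sup>2) \<le> 1 \<longrightarrow> (\<Sum>j<p n. (y j)\<^sup>2) \<le> 1 \<longrightarrow>
      (\<Sum>i<n. \<Sum>j<p n. x i * y j * W n w i j) \<le> \<eta> * sqrt n"
proof -
  \<comment> \<open>Passing from lattice points to all vectors of the unit balls loses a factor
    \<open>2\<close>.\<close>
  define t where "t = \<eta> / 2"
  have t: "t > 0" using \<eta> by (simp add: t_def)
  define S where "S n a b w = (\<Sum>i<n. \<Sum>j<p n. (real_of_int (a i) / (4 * sqrt n)) * (real_of_int (b j) / (4 * sqrt (p n))) * W n w i j)"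
    for n :: nat and a b :: "nat \<Rightarrow> int" and w
  define I where "I n = lattice_ball n \<times> lattice_ball (p n)" for n
  define A where "A n = (\<Union>(a, b)\<in>I n. {w \<in> space M. t * sqrt n < S n a b w})" for n
  have fin: "finite (I n)" for n by (simp add: I_def finite_lattice_ball)
  have Sm [measurable]: "S n a b \<in> borel_measurable M" for n a b
    unfolding S_def[abs_def] by (intro borel_measurable_sum borel_measurable_times meas) auto
  have ev: "{w \<in> space M. t * sqrt n < S n a b w} \<in> events" for n a b by measurable
  have A: "A n \<in> events" for n unfolding A_def by (intro sets.finite_UN fin) (use ev in auto)
  define B :: real where "B = 3 * exp 16"
  have B: "B \<ge> 1" using exp_ge_add_one_self[of "16::real"] by (simp add: B_def)
  define D where "D = real (1 + C) * ln B"
  have D: "D \<ge> 0" using B by (simp add: D_def)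
  \<comment> \<open>\<open>D\<close> is the exponential growth rate of the net of pairs when
    \<open>p n \<le> C * n\<close>. At the tilt \<open>l * sqrt n\<close> the Chernoff bound has
    rate \<open>- l * t = - (D + 2)\<close>, and the parameter \<open>1 / l\<^sup>2\<close> lets the
    exponential moment cost a rate of at most \<open>1\<close>. After the union bound the rate
    \<open>- 1\<close> remains.\<close>
  define l where "l = (D + 2) / t"
  have l: "l > 0" "l * t = D + 2" using t D by (auto simp: l_def)
  have sl: "1 / l\<^sup>2 > 0" using l by simp
  have "\<forall>\<^sub>F n in sequentially. norm (prob (A n)) \<le> exp (- 1) ^ n"
    using subg[OF sl] p eventually_ge_at_top[of 1]
  proof (eventually_elim, goal_cases)
    case (1 n)
    then have n: "n \<ge> 1" by simp
    have sub: "expectation (\<lambda>w. exp (\<Sum>i<n. \<Sum>j<p n. a i j * W n w i j))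
      \<le> exp (1 / l\<^sup>2 * (\<Sum>i<n. \<Sum>j<p n. (a i j)\<^sup>2))" for a using 1 by blast
    have each: "prob {w \<in> space M. t * sqrt n < S n a b w} \<le> exp (- (D + 1) * real n)"
      if ab: "a \<in> lattice_ball n" "b \<in> lattice_ball (p n)" for a b
    proof -
      define u v where "u i = real_of_int (a i) / (4 * sqrt n)" and "v j = real_of_int (b j) / (4 * sqrt (p n))" for i j
      have uv: "(\<Sum>i<n. (u i)\<^sup>2) \<le> 1" "(\<Sum>j<p n. (v j)\<^sup>2) \<le> 1"
        using sum_lattice_ball_le[OF ab(1)] sum_lattice_ball_le[OF ab(2)] by (simp_all add: u_def v_def)
      let ?l = "l * sqrt n"
      have eq: "?l * S n a b w = (\<Sum>i<n. \<Sum>j<p n. (?l * u i * v j) * W n w i j)" for w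
        by (simp add: S_def u_def v_def sum_distrib_left mult.assoc)
      have "\<bar>?l * S n a b w\<bar> \<le> (\<Sum>i<n. \<Sum>j<p n. \<bar>?l * u i * v j\<bar> * K)" if "w \<in> space M" for w
        unfolding eq using bnd[OF that]
        by (intro order_trans[OF sum_abs] sum_mono) (auto simp: abs_mult intro!: mult_left_mono)
      then have int: "integrable M (\<lambda>w. exp (?l * S n a b w))"
        by (intro integrable_const_bound[where B = "exp (\<Sum>i<n. \<Sum>j<p n. \<bar>?l * u i * v j\<bar> * K)"])
          (auto intro: order_trans[OF abs_ge_self])
      have "prob {w \<in> space M. t * sqrt n < S n a b w} \<le> exp (- ?l * (t * sqrt n)) * expectation (\<lambda>w. exp (?l * S n a b w))"
        using l n by (intro prob_gt_le_exp_moment int) auto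
      also have "expectation (\<lambda>w. exp (?l * S n a b w)) \<le> exp (1 / l\<^sup>2 * (\<Sum>i<n. \<Sum>j<p n. (?l * u i * v j)\<^sup>2))"
        unfolding eq by (rule sub)
      \<comment> \<open>The coefficients have rank one, so their sum of squares factorizes, and both
        factors are at most \<open>1\<close> on the net.\<close>
      also have "(\<Sum>i<n. \<Sum>j<p n. (?l * u i * v j)\<^sup>2) = l\<^sup>2 * real n * ((\<Sum>i<n. (u i)\<^sup>2) * (\<Sum>j<p n. (v j)\<^sup>2))"
        unfolding sum_product unfolding sum_distrib_left
        by (intro sum.cong refl) (simp add: power_mult_distrib)
      also have "1 / l\<^sup>2 * \<dots> = real n * ((\<Sum>i<n. (u i)\<^sup>2) * (\<Sum>j<p n. (v j)\<^sup>2))"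
        using l by simp
      also have "\<dots> \<le> real n * 1"
        using uv by (intro mult_left_mono mult_le_one) (auto intro: sum_nonneg)
      also have "- ?l * (t * sqrt n) = - (D + 2) * real n"
      proof -
        have "(l * s) * (t * s) = (l * t) * (s * s)" for s by (simp only: ac_simps)
        from this[of "sqrt n"] show ?thesis unfolding mult_minus_left using l(2) by simp
      qed
      also have "exp (- (D + 2) * real n) * exp (real n * 1) = exp (- (D + 1) * real n)"
        unfolding exp_add[symmetric] by (rule arg_cong[of _ _ exp]) (simp add: algebra_simps)
      finally show ?thesis by simp
    qed
    have "prob (A n) \<le> (\<Sum>(a, b)\<in>I n. prob {w \<in> space M. t * sqrt n < S n a b w})"
      unfolding A_def case_prod_beta using fin ev by (intro finite_measure_subadditive_finite) auto
    also have "\<dots> \<le> (\<Sum>(a, b)\<in>I n. exp (- (D + 1) * real n))"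
      using each by (intro sum_mono) (auto simp: I_def)
    also have "\<dots> = real (card (lattice_ball n)) * real (card (lattice_ball (p n))) * exp (- (D + 1) * real n)"
      by (simp add: I_def case_prod_beta card_cartesian_product)
    also have "\<dots> \<le> B ^ n * B ^ p n * exp (- (D + 1) * real n)"
      using card_lattice_ball[of n] card_lattice_ball[of "p n"] B
      unfolding B_def by (intro mult_right_mono mult_mono) auto
    also have "B ^ n * B ^ p n \<le> B ^ ((1 + C) * n)"
      unfolding power_add[symmetric] using 1 B by (intro power_increasing) (auto simp: algebra_simps)
    also have "B ^ ((1 + C) * n) = exp (D * real n)"
      using B exp_of_nat_mult[of "(1 + C) * n" "ln B"] by (simp add: D_def algebra_simps)
    also have "exp (D * real n) * exp (- (D + 1) * real n) = exp (real n * (- 1))"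
      by (simp add: exp_add[symmetric] algebra_simps)
    also have "\<dots> = exp (- 1) ^ n" by (rule exp_of_nat_mult)
    finally show ?case by simp
  qed
  then have "summable (\<lambda>n. prob (A n))"
    by (rule summable_comparison_test_ev) (auto intro: summable_geometric)
  then have "AE w in M. \<forall>\<^sub>F n in sequentially. w \<in> space M - A n"
    using A by (intro borel_cantelli_AE1) (auto simp: emeasure_eq_measure)
  then show ?thesis
  proof (rule AE_mp, intro AE_I2 impI)
    fix w assume "\<forall>\<^sub>F n in sequentially. w \<in> space M - A n"
    then show "\<forall>\<^sub>F n in sequentially. \<forall>x y. (\<Sum>i<n. (x i)\<^sup>2) \<le> 1 \<longrightarrow> (\<Sum>j<p n. (y j)\<^sup>2) \<le> 1 \<longrightarrow>
      (\<Sum>i<n. \<Sum>j<p n. x i * y j * W n w i j) \<le> \<eta> * sqrt n"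
    proof eventually_elim
      case (elim n)
      then have "S n a b w \<le> t * sqrt n" if "a \<in> lattice_ball n" "b \<in> lattice_ball (p n)" for a b
        using that by (force simp: A_def I_def)
      then have "(\<Sum>i<n. \<Sum>j<p n. x i * y j * W n w i j) \<le> 2 * (t * sqrt n)"
        if "(\<Sum>i<n. (x i)\<^sup>2) \<le> 1" "(\<Sum>j<p n. (y j)\<^sup>2) \<le> 1" for x y
        using t that by (intro bilinear_le_of_lattice_le) (auto simp: S_def)
      then show ?case by (simp add: t_def)
    qed
  qed
qed

subsection \<open>Truncation of a law with density\<close>

lemma borel_measurable_trunc [measurable]: "trunc c \<in> borel_measurable borel"
  unfolding trunc_def[abs_def] by measurable

lemma abs_trunc_le: "c \<ge> 0 \<Longrightarrow> \<bar>trunc c z\<bar> \<le> c"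
  by (simp add: trunc_def)

lemma isCont_trunc:
  assumes "\<bar>z\<bar> \<noteq> c"
  shows "isCont (trunc c) z"
proof (cases "\<bar>z\<bar> < c")
  case True
  have "open {x. \<bar>x\<bar> < c}" by (intro open_Collect_less continuous_intros)
  then have "\<forall>\<^sub>F x in nhds z. x \<in> {x. \<bar>x\<bar> < c}" using True by (intro eventually_nhds_in_open) auto
  then have "\<forall>\<^sub>F x in nhds z. trunc c x = x" by eventually_elim (simp add: trunc_def)
  then show ?thesis by (subst isCont_cong) auto
next
  case False
  have "open {x. c < \<bar>x\<bar>}" by (intro open_Collect_less continuous_intros)
  then have "\<forall>\<^sub>F x in nhds z. x \<in> {x. c < \<bar>x\<bar>}" using False assms by (intro eventually_nhds_in_open) auto
  then have "\<forall>\<^sub>F x in nhds z. trunc c x = 0" by eventually_elim (simp add: trunc_def)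
  then show ?thesis by (subst isCont_cong) auto
qed

text \<open>A density is determined only almost everywhere, but two versions continuous at the same
  point agree there. Continuity thus makes \<open>\<omega> c\<close> and
  \<open>\<omega> (- c)\<close>, and with them \<open>tau\<close>, depend only on
  \<open>\<mu>\<close> and \<open>c\<close>.\<close>

locale density_law =
  fixes \<mu> :: "real measure" and \<omega> :: "real \<Rightarrow> real" and c :: real
  assumes law: "real_distribution \<mu>"
    and meas [measurable]: "\<omega> \<in> borel_measurable borel" and nonneg: "\<And>x. \<omega> x \<ge> 0"
    and dens: "\<mu> = density lborel (\<lambda>x. ennreal (\<omega> x))"
    and cont: "isCont \<omega> c" "isCont \<omega> (- c)"
    and c: "c > 0"
begin

interpretation \<mu>: real_distribution \<mu> by (rule law)

lemma integral_law:
  fixes f :: "real \<Rightarrow> real"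
  assumes [measurable]: "f \<in> borel_measurable borel"
  shows "integral\<^sup>L \<mu> f = (\<integral>x. \<omega> x * f x \<partial>lborel)"
  using nonneg unfolding dens by (subst integral_density) auto

lemma integrable_density: "integrable lborel \<omega>"
proof (rule integrableI_nonneg)
  have "(\<integral>\<^sup>+ x. ennreal (\<omega> x) \<partial>lborel) = emeasure \<mu> UNIV"
    unfolding dens by (simp add: emeasure_density)
  then show "(\<integral>\<^sup>+ x. ennreal (\<omega> x) \<partial>lborel) < \<infinity>"
    using \<mu>.emeasure_space_1 by simp
qed (use nonneg in auto)

lemma set_integrable_density: "A \<in> sets borel \<Longrightarrow> set_integrable lborel A \<omega>"
  unfolding set_integrable_def using integrable_density by (intro integrable_mult_indicator) auto

lemma set_integrable_times_density: "set_integrable lborel {a..b} (\<lambda>z. z * \<omega> z)"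
  unfolding set_integrable_def
proof (rule Bochner_Integration.integrable_bound)
  show "integrable lborel (\<lambda>z. (\<bar>a\<bar> + \<bar>b\<bar>) * \<omega> z)" using integrable_density by simp
  show "AE x in lborel. norm (indicat_real {a..b} x *\<^sub>R (x * \<omega> x)) \<le> norm ((\<bar>a\<bar> + \<bar>b\<bar>) * \<omega> x)"
    using nonneg by (auto simp: indicator_def abs_mult intro!: mult_right_mono)
qed measurable

lemma cdf_diff_eq_integral: "cdf \<mu> c - cdf \<mu> (- c) = integral {- c..c} \<omega>"
proof -
  have "cdf \<mu> c - cdf \<mu> (- c) = measure \<mu> {- c<..c}" using c by (intro \<mu>.cdf_diff_eq) auto
  also have "\<dots> = (\<integral>x. \<omega> x * indicator {- c<..c} x \<partial>lborel)"
    using integral_law[of "indicator {- c<..c}"] by simp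
  also have "\<dots> = (\<integral>x. indicator {- c..c} x *\<^sub>R \<omega> x \<partial>lborel)"
  proof (rule integral_cong_AE)
    show "AE x in lborel. \<omega> x * indicator {- c<..c} x = indicator {- c..c} x *\<^sub>R \<omega> x"
      using AE_lborel_singleton[of "- c"] by eventually_elim (auto simp: indicator_def)
  qed measurable
  also have "\<dots> = integral {- c..c} \<omega>"
    using set_borel_integral_eq_integral(2)[OF set_integrable_density[of "{- c..c}"]]
    by (simp add: set_lebesgue_integral_def)
  finally show ?thesis .
qed

text \<open>The integrand lives on an interval whose endpoints move with \<open>e\<close>; splitting
  \<open>z + e\<close> leaves \<open>e\<close> only in these endpoints and in one explicit factor.
  The base point \<open>- 3 * c\<close> lies to the left of \<open>- c - e\<close> for every
  admissible \<open>e\<close>.\<close>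

lemma integral_trunc_shift:
  assumes e: "\<bar>e\<bar> < c"
  defines "G \<equiv> \<lambda>u. integral {- 3 * c..u} \<omega>" and "H \<equiv> \<lambda>u. integral {- 3 * c..u} (\<lambda>z. z * \<omega> z)"
  shows "(\<integral>z. trunc c (z + e) \<partial>\<mu>) = H (c - e) - H (- c - e) + e * (G (c - e) - G (- c - e))"
proof -
  let ?I = "{- c - e..c - e}"
  have el: "- c < e" "e < c" "e \<le> 2 * c" using e c by linarith+
  have diff: "integral {- 3 * c..c - e} f - integral {- 3 * c..- c - e} f = integral ?I f"
    if "set_integrable lborel {- 3 * c..c - e} f" for f :: "real \<Rightarrow> real"
    using el c Henstock_Kurzweil_Integration.integral_combine[of "- 3 * c" "- c - e" "c - e" f]
      set_borel_integral_eq_integral(1)[OF that] by simp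
  have "(\<integral>z. trunc c (z + e) \<partial>\<mu>) = (\<integral>z. indicator ?I z *\<^sub>R (z * \<omega> z) + e * (indicator ?I z *\<^sub>R \<omega> z) \<partial>lborel)"
  proof (subst integral_law)
    have "\<omega> z * trunc c (z + e) = indicator ?I z *\<^sub>R (z * \<omega> z) + e * (indicator ?I z *\<^sub>R \<omega> z)" for z
    proof -
      have "\<bar>z + e\<bar> \<le> c \<longleftrightarrow> z \<in> ?I" by auto
      then show ?thesis by (simp add: trunc_def indicator_def algebra_simps)
    qed
    then show "(\<integral>z. \<omega> z * trunc c (z + e) \<partial>lborel)
        = (\<integral>z. indicator ?I z *\<^sub>R (z * \<omega> z) + e * (indicator ?I z *\<^sub>R \<omega> z) \<partial>lborel)"
      by (simp only:)
  qed measurable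
  also have "\<dots> = (\<integral>z. indicator ?I z *\<^sub>R (z * \<omega> z) \<partial>lborel) + e * (\<integral>z. indicator ?I z *\<^sub>R \<omega> z \<partial>lborel)"
    using set_integrable_times_density[of "- c - e" "c - e"] set_integrable_density[of ?I]
    unfolding set_integrable_def by (subst Bochner_Integration.integral_add) auto
  also have "\<dots> = integral ?I (\<lambda>z. z * \<omega> z) + e * integral ?I \<omega>"
    using set_borel_integral_eq_integral(2)[OF set_integrable_density[of ?I]]
      set_borel_integral_eq_integral(2)[OF set_integrable_times_density[of "- c - e" "c - e"]]
    by (simp add: set_lebesgue_integral_def)
  finally show ?thesis
    unfolding G_def H_def
    using diff[OF set_integrable_times_density] diff[OF set_integrable_density] by simp
qed

text \<open>The derivative of the endpoints is what produces the density terms of \<open>tau\<close>; continuity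
  of the density at \<open>c\<close> and \<open>- c\<close> alone suffices for the fundamental theorem at these points.\<close>

lemma integral_trunc_shift_has_derivative:
  "((\<lambda>e. \<integral>z. trunc c (z + e) \<partial>\<mu>) has_real_derivative
     cdf \<mu> c - cdf \<mu> (- c) - c * (\<omega> c + \<omega> (- c))) (at 0)"
proof -
  define G H where "G u = integral {- 3 * c..u} \<omega>" and "H u = integral {- 3 * c..u} (\<lambda>z. z * \<omega> z)" for u
  have ftc: "((\<lambda>u. integral {- 3 * c..u} f) has_real_derivative f x) (at x)"
    if "set_integrable lborel {- 3 * c..3 * c} f" "isCont f x" "\<bar>x\<bar> = c" for f :: "real \<Rightarrow> real" and x
  proof -
    have "((\<lambda>u. integral {- 3 * c..u} f) has_vector_derivative f x) (at x within {- 3 * c..3 * c} - {})"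
    proof (rule integral_has_vector_derivative_continuous_at)
      show "f integrable_on {- 3 * c..3 * c}" by (rule set_borel_integral_eq_integral(1)[OF that(1)])
      show "x \<in> {- 3 * c..3 * c} - {}" using that(3) c by auto
      show "continuous (at x within {- 3 * c..3 * c} - {}) f"
        by (rule continuous_at_imp_continuous_at_within[OF that(2)])
    qed simp
    \<comment> \<open>\<open>c\<close> and \<open>- c\<close> are interior points, so the one-sided
      notion becomes a two-sided derivative; an antiderivative started at \<open>- c\<close> would
      fail here.\<close>
    moreover have "at x within {- 3 * c..3 * c} - {} = at x"
      using that c by (simp add: at_within_Icc_at)
    ultimately show ?thesis by (simp add: has_real_derivative_iff_has_vector_derivative)
  qed
  have Gd: "(G has_real_derivative \<omega> x) (at x)" if "isCont \<omega> x" "\<bar>x\<bar> = c" for x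
    unfolding G_def[abs_def] by (rule ftc[OF set_integrable_density that]) simp
  have Hd: "(H has_real_derivative x * \<omega> x) (at x)" if "isCont \<omega> x" "\<bar>x\<bar> = c" for x
    unfolding H_def[abs_def]
    by (rule ftc[OF set_integrable_times_density _ that(2)]) (intro continuous_intros that(1))
  have chain: "((\<lambda>e. F (b - e)) has_real_derivative - D) (at 0)"
    if "(F has_real_derivative D) (at b)" for F D b
  proof -
    have "((\<lambda>e. F (b - e)) has_real_derivative D * (- 1)) (at 0)"
      by (rule DERIV_chain2[where f = F]) (use that in \<open>auto intro!: derivative_eq_intros\<close>)
    then show ?thesis by simp
  qed
  \<comment> \<open>In the product rule the derivatives of the \<open>G\<close> terms are multiplied
    by \<open>e = 0\<close>, so the product leaves the mass \<open>G c - G (- c)\<close>; the moving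
    endpoints in \<open>H\<close> give \<open>- c * (\<omega> c + \<omega> (- c))\<close>.\<close>
  have "((\<lambda>e. H (c - e) - H (- c - e) + e * (G (c - e) - G (- c - e))) has_real_derivative
      (- (c * \<omega> c) - - (- c * \<omega> (- c)) + (1 * (G (c - 0) - G (- c - 0)) + (- \<omega> c - - \<omega> (- c)) * 0))) (at 0)"
    using cont c by (intro DERIV_add DERIV_diff DERIV_mult DERIV_ident chain Gd Hd) auto
  moreover have "G c - G (- c) = integral {- c..c} \<omega>"
    unfolding G_def
    using c Henstock_Kurzweil_Integration.integral_combine[of "- 3 * c" "- c" c \<omega>]
      set_borel_integral_eq_integral(1)[OF set_integrable_density[of "{- 3 * c..c}"]] by simp
  ultimately have "((\<lambda>e. H (c - e) - H (- c - e) + e * (G (c - e) - G (- c - e))) has_real_derivative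
      cdf \<mu> c - cdf \<mu> (- c) - c * (\<omega> c + \<omega> (- c))) (at 0)"
    by (simp add: cdf_diff_eq_integral algebra_simps)
  moreover have "\<forall>\<^sub>F e in nhds 0. (\<integral>z. trunc c (z + e) \<partial>\<mu>)
      = H (c - e) - H (- c - e) + e * (G (c - e) - G (- c - e))"
  proof -
    have "\<forall>\<^sub>F e in nhds 0. e \<in> {- c<..<c}" using c by (intro eventually_nhds_in_open) auto
    then show ?thesis
    proof eventually_elim
      case (elim e)
      then have "\<bar>e\<bar> < c" by auto
      from integral_trunc_shift[OF this] show ?case by (simp add: G_def H_def)
    qed
  qed
  ultimately show ?thesis by (subst DERIV_cong_ev[OF refl _ refl]) auto
qed

lemma integral_trunc_shift_diff_le:
  assumes d: "d > 0"
  obtains \<delta> where "\<delta> > 0"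
    "\<And>e. \<bar>e\<bar> < \<delta> \<Longrightarrow> \<bar>(\<integral>z. trunc c (z + e) \<partial>\<mu>) - (\<integral>z. trunc c z \<partial>\<mu>)
        - (cdf \<mu> c - cdf \<mu> (- c) - c * (\<omega> c + \<omega> (- c))) * e\<bar> \<le> d * \<bar>e\<bar>"
proof -
  define t where "t = cdf \<mu> c - cdf \<mu> (- c) - c * (\<omega> c + \<omega> (- c))"
  define g where "g e = (\<integral>z. trunc c (z + e) \<partial>\<mu>)" for e
  have "(\<lambda>e. (g (0 + e) - g 0) / e) \<midarrow>0\<rightarrow> t"
    using integral_trunc_shift_has_derivative unfolding DERIV_def g_def t_def by simp
  then obtain \<delta> where \<delta>: "\<delta> > 0" "\<And>e. e \<noteq> 0 \<Longrightarrow> \<bar>e\<bar> < \<delta> \<Longrightarrow> \<bar>(g e - g 0) / e - t\<bar> < d"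
    using d unfolding LIM_def dist_real_def by auto
  have "\<bar>g e - g 0 - t * e\<bar> \<le> d * \<bar>e\<bar>" if "\<bar>e\<bar> < \<delta>" for e
  proof (cases "e = 0")
    case False
    have "\<bar>g e - g 0 - t * e\<bar> = \<bar>(g e - g 0) / e - t\<bar> * \<bar>e\<bar>"
      using False by (simp add: abs_mult[symmetric] field_simps)
    also have "\<dots> \<le> d * \<bar>e\<bar>" using \<delta>(2)[OF False that] by (intro mult_right_mono) auto
    finally show ?thesis .
  qed simp
  then show ?thesis using \<delta>(1) by (intro that) (auto simp: g_def t_def)
qed

text \<open>Dominated convergence: the integrand is at most \<open>(2 * c)\<^sup>2\<close> and tends
  to \<open>0\<close> wherever \<open>trunc c\<close> is continuous, that is, off the null set of
  \<open>c\<close> and \<open>- c\<close>.\<close>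

lemma trunc_shift_second_moment_le:
  assumes d: "d > 0"
  obtains \<delta> where "\<delta> > 0" "\<And>e. \<bar>e\<bar> < \<delta> \<Longrightarrow> (\<integral>z. (trunc c (z + e) - trunc c z)\<^sup>2 \<partial>\<mu>) \<le> d"
proof -
  define V where "V e = (\<integral>z. (trunc c (z + e) - trunc c z)\<^sup>2 \<partial>\<mu>)" for e
  have ae: "AE z in \<mu>. z \<noteq> c \<and> z \<noteq> - c"
    unfolding dens by (subst AE_density) (use AE_lborel_singleton[of c] AE_lborel_singleton[of "- c"] in auto)
  have "V \<midarrow>0\<rightarrow> 0"
    unfolding tendsto_at_iff_sequentially
  proof (intro allI impI)
    fix X assume X: "X \<longlonglongrightarrow> (0::real)"
    have "(\<lambda>i. \<integral>z. (trunc c (z + X i) - trunc c z)\<^sup>2 \<partial>\<mu>) \<longlonglongrightarrow> (\<integral>z. 0 \<partial>\<mu>)"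
    proof (rule integral_dominated_convergence[where w = "\<lambda>_. (2 * c)\<^sup>2"])
      show "AE z in \<mu>. (\<lambda>i. (trunc c (z + X i) - trunc c z)\<^sup>2) \<longlonglongrightarrow> 0"
        using ae
      proof eventually_elim
        case (elim z)
        then have "isCont (trunc c) z" by (intro isCont_trunc) auto
        moreover have "(\<lambda>i. z + X i) \<longlonglongrightarrow> z" using tendsto_add[OF tendsto_const[of z] X] by simp
        ultimately have "(\<lambda>i. trunc c (z + X i)) \<longlonglongrightarrow> trunc c z" by (rule isCont_tendsto_compose)
        from tendsto_power[OF tendsto_diff[OF this tendsto_const[of "trunc c z"]], of 2]
        show ?case by simp
      qed
      show "AE z in \<mu>. norm ((trunc c (z + X i) - trunc c z)\<^sup>2) \<le> (2 * c)\<^sup>2" for i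
      proof (rule AE_I2)
        fix z
        have "\<bar>trunc c (z + X i) - trunc c z\<bar> \<le> \<bar>2 * c\<bar>"
          using abs_trunc_le[of c "z + X i"] abs_trunc_le[of c z] c by linarith
        then show "norm ((trunc c (z + X i) - trunc c z)\<^sup>2) \<le> (2 * c)\<^sup>2"
          unfolding abs_le_square_iff by simp
      qed
    qed auto
    then show "(V \<circ> X) \<longlonglongrightarrow> 0" by (simp add: V_def o_def)
  qed
  then obtain \<delta> where \<delta>: "\<delta> > 0" "\<And>e. e \<noteq> 0 \<Longrightarrow> \<bar>e\<bar> < \<delta> \<Longrightarrow> \<bar>V e\<bar> < d"
    using d unfolding LIM_def dist_real_def by auto
  have "V e \<le> d" if "\<bar>e\<bar> < \<delta>" for e
    using \<delta>(2)[OF _ that] d by (cases "e = 0") (auto simp: V_def)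
  then show ?thesis using \<delta>(1) by (intro that) (auto simp: V_def)
qed

end

subsection \<open>Operator norm of the truncated matrices\<close>

text \<open>Testing against the normalized image of \<open>v\<close> recovers the norm of that
  image. The same bound makes the supremum an honest one, which gives its nonnegativity.\<close>

lemma op_norm_le_of_bilinear:
  assumes D: "D \<in> carrier_mat n p"
    and B: "\<And>x y. (\<Sum>i<n. (x i)\<^sup>2) \<le> 1 \<Longrightarrow> (\<Sum>j<p. (y j)\<^sup>2) \<le> 1 \<Longrightarrow> (\<Sum>i<n. \<Sum>j<p. x i * y j * D $$ (i, j)) \<le> B"
  shows "op_norm D \<le> B" "0 \<le> op_norm D"
proof -
  have le: "vec_norm2 (D *\<^sub>v v) \<le> B" if v: "v \<in> carrier_vec p" "vec_norm2 v \<le> 1" for v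
  proof -
    define q where "q = D *\<^sub>v v"
    define N where "N = vec_norm2 q"
    have q: "q \<in> carrier_vec n" using D v by (simp add: q_def)
    have N2: "N\<^sup>2 = (\<Sum>i<n. (vec_index q i)\<^sup>2)"
      unfolding N_def vec_norm2_def using q by (simp add: real_scalar_prod_self sum_nonneg)
    have y: "(\<Sum>j<p. (vec_index v j)\<^sup>2) \<le> 1"
      using v by (simp add: vec_norm2_def real_scalar_prod_self)
    show ?thesis
    proof (cases "N = 0")
      case True
      \<comment> \<open>A zero image cannot be normalized; zero vectors supply
        \<open>0 \<le> B\<close> instead.\<close>
      then show ?thesis using B[of "\<lambda>_. 0" "\<lambda>_. 0"] by (simp add: N_def q_def)
    next
      case False
      have "(\<Sum>i<n. (vec_index q i / N)\<^sup>2) = 1"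
        using False by (simp add: power_divide sum_divide_distrib[symmetric] N2[symmetric])
      then have "(\<Sum>i<n. \<Sum>j<p. (vec_index q i / N) * vec_index v j * D $$ (i, j)) \<le> B"
        using y by (intro B) auto
      also have "(\<Sum>i<n. \<Sum>j<p. (vec_index q i / N) * vec_index v j * D $$ (i, j))
          = (\<Sum>i<n. (vec_index q i / N) * (\<Sum>j<p. D $$ (i, j) * vec_index v j))"
        by (simp add: sum_distrib_left mult_ac)
      also have "\<dots> = (\<Sum>i<n. (vec_index q i)\<^sup>2 / N)"
        using D v(1) by (intro sum.cong refl) (simp add: q_def scalar_prod_def lessThan_atLeast0 power2_eq_square)
      also have "\<dots> = N"
        using False unfolding sum_divide_distrib[symmetric] N2[symmetric] by (simp add: power2_eq_square)
      finally show ?thesis by (simp add: N_def q_def)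
    qed
  qed
  let ?U = "{v \<in> carrier_vec (dim_col D). vec_norm2 v \<le> 1}"
  have z: "0\<^sub>v p \<in> ?U" using D by (simp add: vec_norm2_def)
  show "op_norm D \<le> B" unfolding op_norm_def
  proof (rule cSUP_least)
    show "?U \<noteq> {}" using z by blast
  qed (use le D in auto)
  have "0 \<le> vec_norm2 (D *\<^sub>v 0\<^sub>v p)" by (simp add: vec_norm2_def real_scalar_prod_self sum_nonneg)
  also have "\<dots> \<le> op_norm D"
    unfolding op_norm_def using z le D by (intro cSUP_upper bdd_aboveI2[where M = B]) auto
  finally show "0 \<le> op_norm D" .
qed

lemma bilinear_le_frobenius:
  fixes x y :: "nat \<Rightarrow> real" and m :: "nat \<Rightarrow> nat \<Rightarrow> real"
  assumes x: "(\<Sum>i<n. (x i)\<^sup>2) \<le> 1" and y: "(\<Sum>j<p. (y j)\<^sup>2) \<le> 1"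
  shows "(\<Sum>i<n. \<Sum>j<p. x i * y j * m i j) \<le> sqrt (\<Sum>i<n. \<Sum>j<p. (m i j)\<^sup>2)"
proof -
  let ?T = "{..<n} \<times> {..<p}"
  have "(\<Sum>i<n. \<Sum>j<p. x i * y j * m i j) = (\<Sum>(i, j)\<in>?T. (x i * y j) * m i j)"
    by (simp add: sum.cartesian_product)
  also have "\<dots> \<le> sqrt ((\<Sum>ij\<in>?T. (x (fst ij) * y (snd ij))\<^sup>2) * (\<Sum>ij\<in>?T. (m (fst ij) (snd ij))\<^sup>2))"
    using Cauchy_Schwarz_ineq_sum[of "\<lambda>ij. x (fst ij) * y (snd ij)" "\<lambda>ij. m (fst ij) (snd ij)" ?T]
    by (intro real_le_rsqrt) (simp add: case_prod_beta)
  also have "(\<Sum>ij\<in>?T. (x (fst ij) * y (snd ij))\<^sup>2) = (\<Sum>i<n. (x i)\<^sup>2) * (\<Sum>j<p. (y j)\<^sup>2)"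
    unfolding sum_product sum.cartesian_product by (simp add: case_prod_beta power_mult_distrib)
  also have "(\<Sum>ij\<in>?T. (m (fst ij) (snd ij))\<^sup>2) = (\<Sum>i<n. \<Sum>j<p. (m i j)\<^sup>2)"
    unfolding sum.cartesian_product by (simp add: case_prod_beta)
  also have "sqrt ((\<Sum>i<n. (x i)\<^sup>2) * (\<Sum>j<p. (y j)\<^sup>2) * (\<Sum>i<n. \<Sum>j<p. (m i j)\<^sup>2))
      \<le> sqrt (1 * (\<Sum>i<n. \<Sum>j<p. (m i j)\<^sup>2))"
    using x y by (intro real_sqrt_le_mono mult_right_mono mult_le_one) (auto intro!: sum_nonneg)
  finally show ?thesis by simp
qed

section \<open>Exponential moments of centered increments\<close>

lemma (in prob_space) exp_moment_sum_indep_le: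
  fixes Y :: "'i \<Rightarrow> 'a \<Rightarrow> real"
  assumes fin: "finite T" and indep: "indep_vars (\<lambda>_. borel) Y T"
    and bnd: "\<And>k w. k \<in> T \<Longrightarrow> w \<in> space M \<Longrightarrow> \<bar>Y k w\<bar> \<le> K"
    and sub: "\<And>k l. k \<in> T \<Longrightarrow> expectation (\<lambda>w. exp (l * Y k w)) \<le> exp (s * l\<^sup>2)"
  shows "expectation (\<lambda>w. exp (\<Sum>k\<in>T. a k * Y k w)) \<le> exp (s * (\<Sum>k\<in>T. (a k)\<^sup>2))"
proof -
  have Y: "Y k \<in> borel_measurable M" if "k \<in> T" for k
    using indep that by (auto simp: indep_vars_def)
  have int: "integrable M (\<lambda>w. exp (a k * Y k w))" if k: "k \<in> T" for k
  proof (rule integrable_const_bound[where B = "exp (\<bar>a k\<bar> * K)"])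
    show "AE w in M. norm (exp (a k * Y k w)) \<le> exp (\<bar>a k\<bar> * K)"
    proof (rule AE_I2)
      fix w assume w: "w \<in> space M"
      show "norm (exp (a k * Y k w)) \<le> exp (\<bar>a k\<bar> * K)"
        using mult_left_mono[OF bnd[OF k w], of "\<bar>a k\<bar>"] abs_ge_self[of "a k * Y k w"] by (simp add: abs_mult)
    qed
  qed (use Y[OF k] in measurable)
  have ind: "indep_vars (\<lambda>_. borel) (\<lambda>k w. exp (a k * Y k w)) T"
    using indep_vars_compose2[OF indep, of "\<lambda>k y. exp (a k * y)" "\<lambda>_. borel"] by simp
  have "expectation (\<lambda>w. exp (\<Sum>k\<in>T. a k * Y k w)) = expectation (\<lambda>w. \<Prod>k\<in>T. exp (a k * Y k w))"
    using fin by (simp add: exp_sum)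
  also have "\<dots> = (\<Prod>k\<in>T. expectation (\<lambda>w. exp (a k * Y k w)))"
    by (rule indep_vars_lebesgue_integral[OF fin ind int])
  also have "\<dots> \<le> (\<Prod>k\<in>T. exp (s * (a k)\<^sup>2))" using sub by (intro prod_mono) auto
  also have "\<dots> = exp (s * (\<Sum>k\<in>T. (a k)\<^sup>2))" using fin by (simp add: exp_sum sum_distrib_left)
  finally show ?thesis .
qed

text \<open>The random part of an entry of \<open>sqrt n\<close> times \<open>Y - A\<close>, with
  \<open>e\<close> the scaled entry of \<open>X n\<close>. The exact mean is subtracted, not the
  linear drift; the gap between them is deterministic and is handled by the Frobenius norm.\<close>

definition centered_increment :: "real measure \<Rightarrow> real \<Rightarrow> real \<Rightarrow> real \<Rightarrow> real" where
  "centered_increment \<mu> c e z = trunc c (e + z) - trunc c z - (\<integral>y. trunc c (e + y) - trunc c y \<partial>\<mu>)"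

lemma borel_measurable_centered_increment [measurable]: "centered_increment \<mu> c e \<in> borel_measurable borel"
  unfolding centered_increment_def[abs_def] by measurable

context density_law
begin

interpretation \<mu>: real_distribution \<mu> by (rule law)

lemma integrable_bounded:
  fixes f :: "real \<Rightarrow> real"
  assumes [measurable]: "f \<in> borel_measurable borel" and "\<And>z. \<bar>f z\<bar> \<le> K"
  shows "integrable \<mu> f"
  using assms by (intro \<mu>.integrable_const_bound[where B = K]) auto

lemma abs_increment_le: "\<bar>trunc c (e + z) - trunc c z\<bar> \<le> 2 * c"
  using abs_trunc_le[of c "e + z"] abs_trunc_le[of c z] c by linarith

lemma abs_centered_increment_le: "\<bar>centered_increment \<mu> c e z\<bar> \<le> 4 * c"
proof -
  have "\<bar>\<integral>y. trunc c (e + y) - trunc c y \<partial>\<mu>\<bar> \<le> (\<integral>y. 2 * c \<partial>\<mu>)"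
    using abs_increment_le by (intro integral_abs_bound_integral integrable_bounded[where K = "2 * c"]) (use c in auto)
  then have "\<bar>\<integral>y. trunc c (e + y) - trunc c y \<partial>\<mu>\<bar> \<le> 2 * c" using \<mu>.prob_space by simp
  then show ?thesis using abs_increment_le[of e z] unfolding centered_increment_def by linarith
qed

lemma centered_increment_moments:
  shows "(\<integral>z. centered_increment \<mu> c e z \<partial>\<mu>) = 0"
    and "(\<integral>z. (centered_increment \<mu> c e z)\<^sup>2 \<partial>\<mu>) \<le> (\<integral>z. (trunc c (e + z) - trunc c z)\<^sup>2 \<partial>\<mu>)"
proof -
  let ?h = "\<lambda>z. trunc c (e + z) - trunc c z"
  have i1: "integrable \<mu> ?h" using abs_increment_le by (intro integrable_bounded) auto
  have i2: "integrable \<mu> (\<lambda>z. (?h z)\<^sup>2)"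
  proof (rule integrable_bounded)
    show "\<bar>(?h z)\<^sup>2\<bar> \<le> (2 * c)\<^sup>2" for z
      using power_mono[OF abs_increment_le[of e z], of 2] by simp
  qed measurable
  show "(\<integral>z. centered_increment \<mu> c e z \<partial>\<mu>) = 0"
    unfolding centered_increment_def using i1 \<mu>.prob_space by simp
  have "(\<integral>z. (centered_increment \<mu> c e z)\<^sup>2 \<partial>\<mu>) = (\<integral>z. (?h z)\<^sup>2 \<partial>\<mu>) - (\<integral>z. ?h z \<partial>\<mu>)\<^sup>2"
    unfolding centered_increment_def using i1 i2 by (rule \<mu>.variance_eq)
  then show "(\<integral>z. (centered_increment \<mu> c e z)\<^sup>2 \<partial>\<mu>) \<le> (\<integral>z. (?h z)\<^sup>2 \<partial>\<mu>)" by simp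
qed

lemma centered_increment_subgaussian:
  assumes s: "s > 0"
  obtains \<delta> where "\<delta> > 0"
    "\<And>e l. \<bar>e\<bar> < \<delta> \<Longrightarrow> (\<integral>z. exp (l * centered_increment \<mu> c e z) \<partial>\<mu>) \<le> exp (s * l\<^sup>2)"
proof -
  \<comment> \<open>\<open>L\<close> and \<open>d\<close> meet the two conditions of
    \<open>exp_moment_le\<close> with equality for the uniform bound \<open>4 * c\<close>;
    \<open>d\<close> then dictates how small the shift must be.\<close>
  define L where "L = 4 * c / s"
  have L: "L > 0" "4 * c = s * L" using s c by (auto simp: L_def)
  define d where "d = s / exp (L * (4 * c))"
  have d: "d > 0" "d * exp (L * (4 * c)) = s" using s by (auto simp: d_def)
  obtain \<delta> where \<delta>: "\<delta> > 0" "\<And>e. \<bar>e\<bar> < \<delta> \<Longrightarrow> (\<integral>z. (trunc c (z + e) - trunc c z)\<^sup>2 \<partial>\<mu>) \<le> d"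
    using trunc_shift_second_moment_le[OF d(1)] by blast
  have "(\<integral>z. exp (l * centered_increment \<mu> c e z) \<partial>\<mu>) \<le> exp (s * l\<^sup>2)" if e: "\<bar>e\<bar> < \<delta>" for e l
  proof (rule \<mu>.exp_moment_le)
    show "(\<integral>z. (centered_increment \<mu> c e z)\<^sup>2 \<partial>\<mu>) \<le> d"
      using centered_increment_moments(2)[of e] \<delta>(2)[OF e] by (simp add: add.commute)
  qed (use L d abs_centered_increment_le centered_increment_moments(1) in \<open>auto\<close>)
  then show ?thesis using \<delta>(1) that by blast
qed

text \<open>The factor \<open>2\<close> in the subgaussian hypothesis on the whole matrix pays for off-diagonal entries
  occurring twice in the symmetric setting.\<close>

proposition op_norm_truncation_tendsto_0:
  fixes M :: "'a measure" and X :: "nat \<Rightarrow> real mat" and Z :: "nat \<Rightarrow> 'a \<Rightarrow> real mat"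
    and C :: nat and R :: real
  assumes M: "prob_space M"
    and p: "\<forall>\<^sub>F n in sequentially. p n \<le> C * n"
    and X: "\<And>n. n \<ge> 1 \<Longrightarrow> X n \<in> carrier_mat n (p n)"
    and Zc: "\<And>n w. n \<ge> 1 \<Longrightarrow> w \<in> space M \<Longrightarrow> Z n w \<in> carrier_mat n (p n)"
    and frob: "\<forall>\<^sub>F n in sequentially. (\<Sum>i<n. \<Sum>j<p n. (X n $$ (i, j))\<^sup>2) \<le> R"
    and unif: "\<And>\<epsilon>. \<epsilon> > 0 \<Longrightarrow> \<forall>\<^sub>F n in sequentially.
          \<forall>i < dim_row (X n). \<forall>j < dim_col (X n). \<bar>sqrt (real n) * X n $$ (i, j)\<bar> < \<epsilon>"
    and Zm: "\<And>n i j. n \<ge> 1 \<Longrightarrow> i < n \<Longrightarrow> j < p n \<Longrightarrow> (\<lambda>w. Z n w $$ (i, j)) \<in> borel_measurable M"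
    and Zl: "\<And>n i j. n \<ge> 1 \<Longrightarrow> i < n \<Longrightarrow> j < p n \<Longrightarrow> distr M borel (\<lambda>w. Z n w $$ (i, j)) = \<mu>"
    and sub: "\<And>n s a. n \<ge> 1 \<Longrightarrow> s > 0 \<Longrightarrow>
      (\<And>i j l. i < n \<Longrightarrow> j < p n \<Longrightarrow>
        (\<integral>w. exp (l * centered_increment \<mu> c (sqrt n * X n $$ (i, j)) (Z n w $$ (i, j))) \<partial>M) \<le> exp (s * l\<^sup>2)) \<Longrightarrow>
      (\<integral>w. exp (\<Sum>i<n. \<Sum>j<p n. a i j * centered_increment \<mu> c (sqrt n * X n $$ (i, j)) (Z n w $$ (i, j))) \<partial>M)
        \<le> exp (2 * s * (\<Sum>i<n. \<Sum>j<p n. (a i j)\<^sup>2))"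
    and var_pos: "trunc_var \<mu> c > 0"
  shows "AE w in M. (\<lambda>n. op_norm (Y_mat c X Z n w - A_mat \<mu> \<omega> c X Z n w)) \<longlonglongrightarrow> 0"
proof -
  interpret prob_space M by (rule M)
  define W where "W n w i j = centered_increment \<mu> c (sqrt n * X n $$ (i, j)) (Z n w $$ (i, j))" for n w i j
  define t where "t = cdf \<mu> c - cdf \<mu> (- c) - c * (\<omega> c + \<omega> (- c))"
  have t: "tau \<mu> \<omega> c * sqrt (trunc_var \<mu> c) = t" using var_pos by (simp add: tau_def t_def)
  have dimX: "dim_row (X n) = n" "dim_col (X n) = p n" if "n \<ge> 1" for n using X[OF that] by auto
  have ae: "AE w in M. \<forall>\<^sub>F n in sequentially. \<forall>x y. (\<Sum>i<n. (x i)\<^sup>2) \<le> 1 \<longrightarrow> (\<Sum>j<p n. (y j)\<^sup>2) \<le> 1 \<longrightarrow>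
      (\<Sum>i<n. \<Sum>j<p n. x i * y j * W n w i j) \<le> \<eta> * sqrt n" if \<eta>: "\<eta> > 0" for \<eta> :: real
  proof (rule AE_bilinear_le[OF _ _ p _ \<eta>, where K = "4 * c"])
    fix n i j assume ij: "i < n" "j < p n"
    then have [measurable]: "(\<lambda>w. Z n w $$ (i, j)) \<in> borel_measurable M" by (intro Zm) auto
    show "(\<lambda>w. W n w i j) \<in> borel_measurable M" unfolding W_def by measurable
  next
    fix s :: real assume "s > 0"
    \<comment> \<open>Halving compensates the factor \<open>2\<close> in the conclusion of
      \<open>sub\<close>.\<close>
    then have s: "s / 2 > 0" by simp
    obtain \<delta> where \<delta>: "\<delta> > 0"
      "\<And>e l. \<bar>e\<bar> < \<delta> \<Longrightarrow> (\<integral>z. exp (l * centered_increment \<mu> c e z) \<partial>\<mu>) \<le> exp (s / 2 * l\<^sup>2)"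
      using centered_increment_subgaussian[OF s] by blast
    show "\<forall>\<^sub>F n in sequentially. \<forall>a. expectation (\<lambda>w. exp (\<Sum>i<n. \<Sum>j<p n. a i j * W n w i j))
        \<le> exp (s * (\<Sum>i<n. \<Sum>j<p n. (a i j)\<^sup>2))"
      using unif[OF \<delta>(1)] eventually_ge_at_top[of 1]
    proof eventually_elim
      case (elim n)
      have "expectation (\<lambda>w. exp (l * W n w i j)) \<le> exp (s / 2 * l\<^sup>2)" if ij: "i < n" "j < p n" for i j l
      proof -
        note [measurable] = Zm[OF elim(2) ij]
        have "\<bar>sqrt n * X n $$ (i, j)\<bar> < \<delta>" using elim ij dimX by auto
        from \<delta>(2)[OF this] have "(\<integral>z. exp (l * centered_increment \<mu> c (sqrt n * X n $$ (i, j)) z)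
            \<partial>distr M borel (\<lambda>w. Z n w $$ (i, j))) \<le> exp (s / 2 * l\<^sup>2)"
          using Zl[OF elim(2) ij] by simp
        then show ?thesis by (subst (asm) integral_distr) (auto simp: W_def)
      qed
      then show ?case using sub[OF elim(2) s] unfolding W_def by simp
    qed
  qed (simp add: W_def abs_centered_increment_le)
  \<comment> \<open>The null set must be fixed before \<open>\<epsilon>\<close>; countably many
    thresholds make this possible.\<close>
  have "AE w in M. \<forall>k::nat. \<forall>\<^sub>F n in sequentially. \<forall>x y. (\<Sum>i<n. (x i)\<^sup>2) \<le> 1 \<longrightarrow> (\<Sum>j<p n. (y j)\<^sup>2) \<le> 1 \<longrightarrow>
      (\<Sum>i<n. \<Sum>j<p n. x i * y j * W n w i j) \<le> (1 / real (Suc k)) * sqrt n"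
    unfolding AE_all_countable by (intro allI ae) simp
  then show ?thesis
  proof (rule AE_mp, intro AE_I2 impI)
    fix w assume w: "w \<in> space M"
      and W: "\<forall>k::nat. \<forall>\<^sub>F n in sequentially. \<forall>x y. (\<Sum>i<n. (x i)\<^sup>2) \<le> 1 \<longrightarrow> (\<Sum>j<p n. (y j)\<^sup>2) \<le> 1 \<longrightarrow>
      (\<Sum>i<n. \<Sum>j<p n. x i * y j * W n w i j) \<le> (1 / real (Suc k)) * sqrt n"
    show "(\<lambda>n. op_norm (Y_mat c X Z n w - A_mat \<mu> \<omega> c X Z n w)) \<longlonglongrightarrow> 0"
    proof (rule tendstoI)
      fix \<epsilon> :: real assume \<epsilon>: "\<epsilon> > 0"
      then obtain k where k: "1 / real (Suc k) < \<epsilon> / 2" using nat_approx_posE[of "\<epsilon> / 2"] by auto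
      \<comment> \<open>Chosen so that the Frobenius norm of the mean matrix is at most
        \<open>\<epsilon> / 4\<close>; the \<open>1\<close> avoids a zero denominator.\<close>
      define d where "d = \<epsilon> / 4 / (sqrt \<bar>R\<bar> + 1)"
      have "sqrt \<bar>R\<bar> + 1 > 0" by (simp add: add_nonneg_pos)
      then have d: "d > 0" "d * sqrt \<bar>R\<bar> \<le> \<epsilon> / 4" using \<epsilon> by (auto simp: d_def field_simps)
      obtain \<delta> where \<delta>: "\<delta> > 0" "\<And>e. \<bar>e\<bar> < \<delta> \<Longrightarrow>
          \<bar>(\<integral>z. trunc c (z + e) \<partial>\<mu>) - (\<integral>z. trunc c z \<partial>\<mu>) - t * e\<bar> \<le> d * \<bar>e\<bar>"
        using integral_trunc_shift_diff_le[OF d(1)] unfolding t_def by blast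
      show "\<forall>\<^sub>F n in sequentially. dist (op_norm (Y_mat c X Z n w - A_mat \<mu> \<omega> c X Z n w)) 0 < \<epsilon>"
        using W[rule_format, of k] frob unif[OF \<delta>(1)] eventually_ge_at_top[of 1]
      proof eventually_elim
        case (elim n)
        let ?D = "Y_mat c X Z n w - A_mat \<mu> \<omega> c X Z n w"
        have n: "sqrt n > 0" using elim(4) by simp
        have Xn: "X n \<in> carrier_mat n (p n)" and Zn: "Z n w \<in> carrier_mat n (p n)"
          using X Zc elim(4) w by auto
        have D: "?D \<in> carrier_mat n (p n)" using Xn Zn by (intro carrier_matI) (simp_all add: Y_mat_def A_mat_def)
        \<comment> \<open>The mean of the increment minus its linear part. The shift carries a
          factor \<open>sqrt n\<close>, so the division leaves an error of at most
          \<open>d * \<bar>X n $$ (i, j)\<bar>\<close>.\<close>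
        define m where "m i j = ((\<integral>y. trunc c (sqrt n * X n $$ (i, j) + y) - trunc c y \<partial>\<mu>)
            - t * (sqrt n * X n $$ (i, j))) / sqrt n" for i j
        have ent: "?D $$ (i, j) = W n w i j / sqrt n + m i j" if "i < n" "j < p n" for i j
        proof -
          have alg: "(A - B - I) / q + (I - t * (q * x)) / q = A / q - (t * x + B / q)" if "q \<noteq> 0" for A B I q x :: real
            using that by (simp add: diff_divide_distrib)
          have "W n w i j / sqrt n + m i j = trunc c (sqrt n * X n $$ (i, j) + Z n w $$ (i, j)) / sqrt n
              - (t * X n $$ (i, j) + trunc c (Z n w $$ (i, j)) / sqrt n)"
            unfolding W_def centered_increment_def m_def using n by (intro alg) simp
          then show ?thesis using that Xn Zn unfolding Y_mat_def A_mat_def t by simp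
        qed
        have m: "(m i j)\<^sup>2 \<le> d\<^sup>2 * (X n $$ (i, j))\<^sup>2" if ij: "i < n" "j < p n" for i j
        proof -
          let ?e = "sqrt n * X n $$ (i, j)"
          have i: "integrable \<mu> (\<lambda>y. trunc c (?e + y))" "integrable \<mu> (trunc c)"
            using abs_trunc_le[of c] c by (auto intro!: integrable_bounded[where K = c])
          have "\<bar>?e\<bar> < \<delta>" using elim(3) ij Xn by auto
          from \<delta>(2)[OF this] have "\<bar>m i j * sqrt n\<bar> \<le> d * \<bar>?e\<bar>"
            using n i by (simp add: m_def add.commute)
          then have "\<bar>m i j\<bar> * sqrt n \<le> (d * \<bar>X n $$ (i, j)\<bar>) * sqrt n"
            using n by (simp add: abs_mult mult_ac)
          then have "\<bar>m i j\<bar> \<le> \<bar>d * X n $$ (i, j)\<bar>" using n d(1) by (simp add: abs_mult)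
          then show ?thesis unfolding abs_le_square_iff by (simp add: power_mult_distrib)
        qed
        have "sqrt (\<Sum>i<n. \<Sum>j<p n. (m i j)\<^sup>2) \<le> sqrt (d\<^sup>2 * \<bar>R\<bar>)"
        proof (rule real_sqrt_le_mono)
          have "(\<Sum>i<n. \<Sum>j<p n. (m i j)\<^sup>2) \<le> (\<Sum>i<n. \<Sum>j<p n. d\<^sup>2 * (X n $$ (i, j))\<^sup>2)"
            using m by (intro sum_mono) auto
          also have "\<dots> = d\<^sup>2 * (\<Sum>i<n. \<Sum>j<p n. (X n $$ (i, j))\<^sup>2)" by (simp add: sum_distrib_left)
          also have "\<dots> \<le> d\<^sup>2 * \<bar>R\<bar>" using elim(2) by (intro mult_left_mono) auto
          finally show "(\<Sum>i<n. \<Sum>j<p n. (m i j)\<^sup>2) \<le> d\<^sup>2 * \<bar>R\<bar>" .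
        qed
        also have "\<dots> \<le> \<epsilon> / 4" using d by (simp add: real_sqrt_mult)
        finally have frobm: "sqrt (\<Sum>i<n. \<Sum>j<p n. (m i j)\<^sup>2) \<le> \<epsilon> / 4" .
        \<comment> \<open>\<open>\<epsilon> / 2\<close> from the random part and
          \<open>\<epsilon> / 4\<close> from the mean; the slack keeps the inequality strict after
          the supremum.\<close>
        have "(\<Sum>i<n. \<Sum>j<p n. x i * y j * ?D $$ (i, j)) \<le> 3 * \<epsilon> / 4"
          if x: "(\<Sum>i<n. (x i)\<^sup>2) \<le> 1" and y: "(\<Sum>j<p n. (y j)\<^sup>2) \<le> 1" for x y
        proof -
          have "(\<Sum>i<n. \<Sum>j<p n. x i * y j * ?D $$ (i, j))
              = (\<Sum>i<n. \<Sum>j<p n. x i * y j * W n w i j / sqrt n + x i * y j * m i j)"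
            using ent by (intro sum.cong refl) (simp add: algebra_simps)
          also have "\<dots> = (\<Sum>i<n. \<Sum>j<p n. x i * y j * W n w i j) / sqrt n + (\<Sum>i<n. \<Sum>j<p n. x i * y j * m i j)"
            by (simp add: sum.distrib sum_divide_distrib)
          also have "(\<Sum>i<n. \<Sum>j<p n. x i * y j * W n w i j) / sqrt n \<le> 1 / real (Suc k)"
            using elim(1) x y n by (simp add: divide_le_eq)
          also have "(\<Sum>i<n. \<Sum>j<p n. x i * y j * m i j) \<le> \<epsilon> / 4"
            using bilinear_le_frobenius[OF x y, of m] frobm by linarith
          finally show ?thesis using k by simp
        qed
        from op_norm_le_of_bilinear[OF D this] show ?case using \<epsilon> by simp
      qed
    qed
  qed
qed

end

section \<open>Specialization to the asymmetric and the symmetric setting\<close>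

lemma sum_square_eq_sum_upper_triangle:
  fixes f :: "nat \<Rightarrow> nat \<Rightarrow> 'a :: comm_monoid_add"
  shows "(\<Sum>i<n. \<Sum>j<n. f i j) = (\<Sum>(i, j)\<in>{(i, j). i \<le> j \<and> j < n}. if i = j then f i i else f i j + f j i)"
proof -
  let ?T = "{(i, j). i \<le> j \<and> j < n}" and ?L = "{(i, j). j < i \<and> i < n}"
  have fin: "finite ?T" "finite ?L"
    by (rule finite_subset[of _ "{..<n} \<times> {..<n}"]; auto)+
  have sq: "{..<n} \<times> {..<n} = ?T \<union> ?L" by auto
  have "(\<Sum>i<n. \<Sum>j<n. f i j) = (\<Sum>(i, j)\<in>?T \<union> ?L. f i j)"
    by (simp add: sum.cartesian_product sq)
  also have "\<dots> = (\<Sum>(i, j)\<in>?T. f i j) + (\<Sum>(i, j)\<in>?L. f i j)"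
    using fin by (intro sum.union_disjoint) auto
  also have "(\<Sum>(i, j)\<in>?L. f i j) = (\<Sum>(i, j)\<in>{(i, j). i < j \<and> j < n}. f j i)"
    by (rule sum.reindex_bij_witness[of _ prod.swap prod.swap]) auto
  also have "\<dots> = (\<Sum>(i, j)\<in>?T. if i = j then 0 else f j i)"
    using fin by (intro sum.mono_neutral_cong_left) (auto split: if_splits)
  also have "(\<Sum>(i, j)\<in>?T. f i j) + \<dots> = (\<Sum>(i, j)\<in>?T. if i = j then f i i else f i j + f j i)"
    unfolding sum.distrib[symmetric] by (intro sum.cong refl) auto
  finally show ?thesis .
qed

lemma (in asymmetric_setting) op_norm_tendsto_0:
  assumes law: "density_law \<mu> \<omega> c"
    and unif: "\<And>\<epsilon>. \<epsilon> > 0 \<Longrightarrow> \<forall>\<^sub>F n in sequentially.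
          \<forall>i < dim_row (X n). \<forall>j < dim_col (X n). \<bar>sqrt (real n) * X n $$ (i, j)\<bar> < \<epsilon>"
    and var_pos: "trunc_var \<mu> c > 0"
  shows "AE w in M. (\<lambda>n. op_norm (Y_mat c X Z n w - A_mat \<mu> \<omega> c X Z n w)) \<longlonglongrightarrow> 0"
proof -
  interpret d: density_law \<mu> \<omega> c by (rule law)
  \<comment> \<open>The inserted \<open>0\<close> covers rank \<open>0\<close> and a vanishing
    singular value.\<close>
  define S where "S = Max (insert 0 (sg ` {1..r}))"
  show ?thesis
  proof (rule d.op_norm_truncation_tendsto_0[where p = p and M = M and X = X and Z = Z
        and C = "nat \<lceil>\<gamma>\<rceil> + 1" and R = "real r * S\<^sup>2",
        OF prob_space_axioms _ X_carrier Z_carrier _ unif _ Z_law _ var_pos])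
    have "\<forall>\<^sub>F n in sequentially. real (p n) / real n < \<gamma> + 1"
      using order_tendstoD(2)[OF aspect_ratio, of "\<gamma> + 1"] by simp
    then show "\<forall>\<^sub>F n in sequentially. p n \<le> (nat \<lceil>\<gamma>\<rceil> + 1) * n"
      using eventually_ge_at_top[of 1]
    proof eventually_elim
      case (elim n)
      then have "real (p n) \<le> (\<gamma> + 1) * real n" by (simp add: field_simps)
      also have "\<dots> \<le> real (nat \<lceil>\<gamma>\<rceil> + 1) * real n"
        by (intro mult_right_mono) (auto simp: real_nat_ceiling_ge)
      finally have "real (p n) \<le> real ((nat \<lceil>\<gamma>\<rceil> + 1) * n)" by (simp only: of_nat_mult)
      then show ?case by (simp only: of_nat_le_iff)
    qed
    show "\<forall>\<^sub>F n in sequentially. (\<Sum>i<n. \<Sum>j<p n. (X n $$ (i, j))\<^sup>2) \<le> real r * S\<^sup>2"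
      using X_rank X_singular_values eventually_ge_at_top[of 1]
    proof eventually_elim
      case (elim n)
      have "s \<le> S" if "singular_value (X n) s" for s
      proof -
        have "s \<in> insert 0 (sg ` {1..r})" using that elim(2) by auto
        then show ?thesis unfolding S_def by (intro Max_ge) auto
      qed
      from frobenius_le_rank_times_singular_value[OF X_carrier[OF elim(3)] this]
      show ?case using elim(1) by simp
    qed
    show "(\<lambda>w. Z n w $$ (i, j)) \<in> borel_measurable M" if "n \<ge> 1" "i < n" "j < p n" for n i j
      using Z_indep[OF that(1)] that by (auto simp: indep_vars_def)
  next
    fix n s and a :: "nat \<Rightarrow> nat \<Rightarrow> real"
    assume n: "n \<ge> 1" and s: "(s::real) > 0"
      and sub: "\<And>i j l. i < n \<Longrightarrow> j < p n \<Longrightarrow>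
        expectation (\<lambda>w. exp (l * centered_increment \<mu> c (sqrt n * X n $$ (i, j)) (Z n w $$ (i, j)))) \<le> exp (s * l\<^sup>2)"
    let ?T = "{..<n} \<times> {..<p n}"
    let ?Y = "\<lambda>ij w. centered_increment \<mu> c (sqrt n * X n $$ ij) (Z n w $$ ij)"
    have "indep_vars (\<lambda>_. borel) ?Y ?T"
      using indep_vars_compose2[OF Z_indep[OF n], of "\<lambda>ij. centered_increment \<mu> c (sqrt n * X n $$ ij)" "\<lambda>_. borel"]
      by simp
    then have "expectation (\<lambda>w. exp (\<Sum>ij\<in>?T. a (fst ij) (snd ij) * ?Y ij w))
        \<le> exp (s * (\<Sum>ij\<in>?T. (a (fst ij) (snd ij))\<^sup>2))"
      using sub d.abs_centered_increment_le by (intro exp_moment_sum_indep_le[where K = "4 * c"]) auto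
    \<comment> \<open>Independence of all entries already yields \<open>s\<close>; it is weakened to
      fit the common form.\<close>
    also have "\<dots> \<le> exp (2 * s * (\<Sum>ij\<in>?T. (a (fst ij) (snd ij))\<^sup>2))"
      unfolding exp_le_cancel_iff using s by (intro mult_right_mono sum_nonneg) auto
    finally show "expectation (\<lambda>w. exp (\<Sum>i<n. \<Sum>j<p n. a i j * ?Y (i, j) w))
        \<le> exp (2 * s * (\<Sum>i<n. \<Sum>j<p n. (a i j)\<^sup>2))"
      by (simp add: sum.cartesian_product case_prod_beta)
  qed
qed

lemma (in symmetric_setting) op_norm_tendsto_0:
  assumes law: "density_law \<mu> \<omega> c"
    and unif: "\<And>\<epsilon>. \<epsilon> > 0 \<Longrightarrow> \<forall>\<^sub>F n in sequentially.
          \<forall>i < dim_row (X n). \<forall>j < dim_col (X n). \<bar>sqrt (real n) * X n $$ (i, j)\<bar> < \<epsilon>"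
    and var_pos: "trunc_var \<mu> c > 0"
  shows "AE w in M. (\<lambda>n. op_norm (Y_mat c X Z n w - A_mat \<mu> \<omega> c X Z n w)) \<longlonglongrightarrow> 0"
proof -
  interpret d: density_law \<mu> \<omega> c by (rule law)
  \<comment> \<open>Absolute values, since a negative eigenvalue gives a positive singular
    value.\<close>
  define S where "S = Max (insert 0 ((\<lambda>k. \<bar>ev k\<bar>) ` {1..r}))"
  have Zsym: "Z n w $$ (i, j) = Z n w $$ (j, i)" if "n \<ge> 1" "w \<in> space M" "i < n" "j < n" for n w i j
    using arg_cong[OF Z_sym[OF that(1,2)], of "\<lambda>A. A $$ (i, j)"] Z_carrier[OF that(1,2)] that by simp
  have Xsym: "X n $$ (i, j) = X n $$ (j, i)" if "n \<ge> 1" "i < n" "j < n" for n i j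
    using arg_cong[OF X_sym[OF that(1)], of "\<lambda>A. A $$ (i, j)"] X_carrier[OF that(1)] that by simp
  have Zu: "(\<lambda>w. Z n w $$ (i, j)) \<in> borel_measurable M" if "n \<ge> 1" "i \<le> j" "j < n" for n i j
    using Z_indep[OF that(1)] that by (auto simp: indep_vars_def)
  \<comment> \<open>Law and measurability are given on the upper triangle and pass to the lower one
    by symmetry.\<close>
  have Zall: "(\<lambda>w. Z n w $$ (i, j)) \<in> borel_measurable M \<and> distr M borel (\<lambda>w. Z n w $$ (i, j)) = \<mu>"
    if n: "n \<ge> 1" "i < n" "j < n" for n i j
  proof (cases "i \<le> j")
    case True
    then show ?thesis using Zu Z_law n by simp
  next
    case False
    then have ji: "(\<lambda>w. Z n w $$ (j, i)) \<in> borel_measurable M" "distr M borel (\<lambda>w. Z n w $$ (j, i)) = \<mu>"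
      using Zu Z_law n by simp_all
    have "(\<lambda>w. Z n w $$ (i, j)) \<in> borel_measurable M"
      by (rule measurable_cong[THEN iffD2, OF _ ji(1)]) (rule Zsym[OF n(1) _ n(2,3)])
    moreover have "distr M borel (\<lambda>w. Z n w $$ (i, j)) = distr M borel (\<lambda>w. Z n w $$ (j, i))"
      using Zsym n by (intro distr_cong) auto
    ultimately show ?thesis using ji(2) by simp
  qed
  show ?thesis
  proof (rule d.op_norm_truncation_tendsto_0[where p = "\<lambda>n. n" and M = M and X = X and Z = Z and C = 1 and R = "real r * S\<^sup>2",
        OF prob_space_axioms _ X_carrier Z_carrier _ unif _ _ _ var_pos])
    show "\<forall>\<^sub>F n in sequentially. (\<Sum>i<n. \<Sum>j<n. (X n $$ (i, j))\<^sup>2) \<le> real r * S\<^sup>2"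
      using X_rank X_eigenvalues eventually_ge_at_top[of 1]
    proof eventually_elim
      case (elim n)
      have "s \<le> S" if "singular_value (X n) s" for s
      proof -
        from symmetric_singular_value[OF X_carrier[OF elim(3)] X_sym[OF elim(3)] that]
        obtain l where "eigenvalue (X n) l" "\<bar>l\<bar> = \<bar>s\<bar>" by auto
        then have "l = 0 \<or> l \<in> ev ` {1..r}" using elim(2) by blast
        then have "\<bar>l\<bar> \<in> insert 0 ((\<lambda>k. \<bar>ev k\<bar>) ` {1..r})" by auto
        then have "\<bar>s\<bar> \<in> insert 0 ((\<lambda>k. \<bar>ev k\<bar>) ` {1..r})" using \<open>\<bar>l\<bar> = \<bar>s\<bar>\<close> by simp
        then have "\<bar>s\<bar> \<le> S" unfolding S_def by (intro Max_ge) auto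
        then show ?thesis by simp
      qed
      from frobenius_le_rank_times_singular_value[OF X_carrier[OF elim(3)] this]
      show ?case using elim(1) by simp
    qed
  next
    fix n s and a :: "nat \<Rightarrow> nat \<Rightarrow> real"
    assume n: "n \<ge> 1" and s: "(s::real) > 0"
      and sub: "\<And>i j l. i < n \<Longrightarrow> j < n \<Longrightarrow>
        expectation (\<lambda>w. exp (l * centered_increment \<mu> c (sqrt n * X n $$ (i, j)) (Z n w $$ (i, j)))) \<le> exp (s * l\<^sup>2)"
    let ?T = "{(i, j). i \<le> j \<and> j < n}"
    let ?Y = "\<lambda>ij w. centered_increment \<mu> c (sqrt n * X n $$ ij) (Z n w $$ ij)"
    \<comment> \<open>Folding the square onto the upper triangle produces a combination of
      independent variables; an off-diagonal one collects both of its coefficients, and the square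
      of their sum is at most twice the sum of their squares.\<close>
    define b where "b ij = (case ij of (i, j) \<Rightarrow> if i = j then a i i else a i j + a j i)" for ij
    have fin: "finite ?T" by (rule finite_subset[of _ "{..<n} \<times> {..<n}"]) auto
    have eq: "(\<Sum>i<n. \<Sum>j<n. a i j * ?Y (i, j) w) = (\<Sum>ij\<in>?T. b ij * ?Y ij w)" if w: "w \<in> space M" for w
    proof -
      have "?Y (j, i) w = ?Y (i, j) w" if "i < n" "j < n" for i j
        using Xsym[OF n that] Zsym[OF n w that] by simp
      then show ?thesis
        unfolding sum_square_eq_sum_upper_triangle by (intro sum.cong refl) (auto simp: b_def algebra_simps)
    qed
    have "indep_vars (\<lambda>_. borel) ?Y ?T"
      using indep_vars_compose2[OF Z_indep[OF n], of "\<lambda>ij. centered_increment \<mu> c (sqrt n * X n $$ ij)" "\<lambda>_. borel"]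
      by simp
    then have "expectation (\<lambda>w. exp (\<Sum>ij\<in>?T. b ij * ?Y ij w)) \<le> exp (s * (\<Sum>ij\<in>?T. (b ij)\<^sup>2))"
      using sub d.abs_centered_increment_le fin by (intro exp_moment_sum_indep_le[where K = "4 * c"]) auto
    \<comment> \<open>Symmetry of \<open>Z n w\<close> is known only on \<open>space M\<close>,
      which suffices for equality of the integrals.\<close>
    also have "expectation (\<lambda>w. exp (\<Sum>ij\<in>?T. b ij * ?Y ij w))
        = expectation (\<lambda>w. exp (\<Sum>i<n. \<Sum>j<n. a i j * ?Y (i, j) w))"
      by (intro Bochner_Integration.integral_cong refl) (simp add: eq)
    also have "(\<Sum>ij\<in>?T. (b ij)\<^sup>2) \<le> (\<Sum>i<n. \<Sum>j<n. 2 * (a i j)\<^sup>2)"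
      unfolding sum_square_eq_sum_upper_triangle
    proof (rule sum_mono, clarify)
      fix i j
      have "(a i j + a j i)\<^sup>2 \<le> 2 * (a i j)\<^sup>2 + 2 * (a j i)\<^sup>2"
        using sum_squares_bound[of "a i j" "a j i"] by (simp add: power2_sum)
      then show "(b (i, j))\<^sup>2 \<le> (if i = j then 2 * (a i i)\<^sup>2 else 2 * (a i j)\<^sup>2 + 2 * (a j i)\<^sup>2)"
        by (simp add: b_def)
    qed
    finally show "expectation (\<lambda>w. exp (\<Sum>i<n. \<Sum>j<n. a i j * ?Y (i, j) w))
        \<le> exp (2 * s * (\<Sum>i<n. \<Sum>j<n. (a i j)\<^sup>2))"
      using s by (simp add: sum_distrib_left mult_ac)
  qed (use Zall in auto)
qed

theorem corollary3p4:
  fixes M :: "'a measure" and \<mu> :: "real measure"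
    and X :: "nat \<Rightarrow> real mat" and Z :: "nat \<Rightarrow> 'a \<Rightarrow> real mat"
    and p :: "nat \<Rightarrow> nat" and \<gamma> :: real and r :: nat and sg ev :: "nat \<Rightarrow> real"
    and c :: real and \<omega> :: "real \<Rightarrow> real"
  assumes setting: "asymmetric_setting M \<mu> p \<gamma> r sg X Z \<or> symmetric_setting M \<mu> r ev X Z"
    and c_pos: "c > 0"
    and X_unif: "\<And>\<epsilon>. \<epsilon> > 0 \<Longrightarrow> \<forall>\<^sub>F n in sequentially.
          \<forall>i < dim_row (X n). \<forall>j < dim_col (X n). \<bar>sqrt (real n) * X n $$ (i, j)\<bar> < \<epsilon>"
    and dens_meas: "\<omega> \<in> borel_measurable borel"
    and dens_nonneg: "\<And>x. \<omega> x \<ge> 0"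
    and dens: "\<mu> = density lborel (\<lambda>x. ennreal (\<omega> x))"
    and dens_cont: "isCont \<omega> c" "isCont \<omega> (- c)"
    and var_pos: "trunc_var \<mu> c > 0"
  shows "AE w in M. (\<lambda>n. op_norm (Y_mat c X Z n w - A_mat \<mu> \<omega> c X Z n w)) \<longlonglongrightarrow> 0"
proof -
  from setting have law: "real_distribution \<mu>"
    by (auto simp: asymmetric_setting_def symmetric_setting_def)
  have d: "density_law \<mu> \<omega> c"
    using law dens_meas dens_nonneg dens dens_cont c_pos by (intro density_law.intro)
  from setting show ?thesis
  proof
    assume "asymmetric_setting M \<mu> p \<gamma> r sg X Z"
    then show ?thesis by (rule asymmetric_setting.op_norm_tendsto_0[OF _ d X_unif var_pos])
  next
    assume "symmetric_setting M \<mu> r ev X Z"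
    then show ?thesis by (rule symmetric_setting.op_norm_tendsto_0[OF _ d X_unif var_pos])
  qed
qed

end
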